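(* Let $\mathcal{T}_{\mathcal{A}}$ be an interventional staged tree. Then $\mathcal{T}_{\mathcal{A}}$ is balanced if and only if $$\ker(\Psi^{\mathsf{toric}}_{\mathcal{T}_{\mathcal{A}}})=\ker(\Psi_{\mathcal{T}_{\mathcal{A}}}).$$ In particular, in this case, $\ker(\Psi_{\mathcal{T}_{\mathcal{A}}})$ is a toric ideal.
   Context: **Staged trees.** $\mathcal{T}=(V,E)$ is a finite rooted tree with root $r$, edges directed away from $r$. $E(v)$ is the set of edges leaving $v$; $L_i$ is the set of vertices at distance $i$ from $r$. Given a surjective labeling $\theta$ of the edges, $\theta_v=\{\theta(e):e\in E(v)\}$. $(\mathcal{T},\theta)$ is a staged tree if $|\theta_v|=|E(v)|$ for all $v$ and any two sets $\theta_v,\theta_w$ are equal or disjoint. Vertices $v,w$ are in the same stage if $\theta_v=\theta_w$. For a vertex $u$, $\mathcal{T}_u=(V_u,E_u)$ is the subtree consisting of $u$ and its descendants, and $\mathbf{i}_{\mathcal{T}_u}$ its set of leaves. **Interventional staged trees.** Let $\theta:E\to\mathcal{A}\sqcup\mathcal{L}$ be a surjective labeling with partitioned label set such that $(\mathcal{T},\theta)$ is a staged tree. It is an interventional staged tree, denoted $\mathcal{T}_{\mathcal{A}}$, with splitting level $k^*$ ($k^*$ less than the largest level of $\mathcal{T}$) if: (0) the set of labels of edges leaving vertices of level $<k^*$ is $\mathcal{A}$ and the set of labels of edges leaving vertices of level $\ge k^*$ is $\mathcal{L}$; (i) each $\mathcal{T}_u$, $u\in L_{k^*}$, is a staged tree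 with the restricted labeling; (ii) the trees $\mathcal{T}_u$, $u\in L_{k^*}$, are all isomorphic (via fixed isomorphisms) to one rooted tree $\mathcal{T}_{\mathcal{L}}=(V_{\mathcal{L}},E_{\mathcal{L}})$ with root $r_{\mathcal{L}}$; (iii) the elements of $\mathcal{A}$ are labels $a_S$ indexed by subsets $S\subset V_{\mathcal{L}}\setminus\{r_{\mathcal{L}}\}$; (iv) for $u,w\in L_{k^*}$ and edges $e_u\in E_u$, $e_w\in E_w$ identified with the same edge of $\mathcal{T}_{\mathcal{L}}$, pointing into $v\in V_{\mathcal{L}}$: if $v\notin S$ for every $a_S$ labeling an edge on the undirected path between $u$ and $w$, then $\theta(e_u)=\theta(e_w)$, and otherwise $\theta(e_u)\ne\theta(e_w)$. It is also assumed that no two distinct non-leaf vertices of level $<k^*$ are in the same stage. **Balanced.** For a vertex $v$, the interpolating polynomial $t(v)$ is the sum, over all directed paths $\lambda$ from $v$ to a leaf, of $\prod_{e\in\lambda}\theta(e)$, in the polynomial ring over $\mathbb{R}$ with the labels as indeterminates ($t(v)=1$ for a leaf). Vertices $v,w$ in the same stage with children $v_0,\ldots,v_m$ and $w_0,\ldots,w_m$, indexed so that $\theta(v\to v_i)=\theta(w\to w_i)$, are balanced if $t(v_i)t(w_j)=t(w_i)t(v_j)$ for all $i\neq j$. The tree is balanced if every pair of vertices in the same stage is balanced. **Ideals.** $\mathbb{R}[D_{\mathcal{T}_{\mathcal{A}}}]=\mathbb{R}[p^{(u)}_{\ell}:u\in L_{k^*},\ell\in\mathbf{i}_{\mathcal{T}_u}]$.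 The map $\Psi^{\mathsf{toric}}_{\mathcal{T}_{\mathcal{A}}}:\mathbb{R}[D_{\mathcal{T}_{\mathcal{A}}}]\to\mathbb{R}[a_u,\mathcal{L}:u\in L_{k^*}]$ sends $p^{(u)}_\ell\mapsto a_u\prod_{e\in\lambda_{u,\ell}}\theta(e)$, where the $a_u$ are indeterminates (one for each $u\in L_{k^*}$), the labels in $\mathcal{L}$ are treated as indeterminates, and $\lambda_{u,\ell}$ is the path from $u$ to $\ell$. $\mathfrak{q}_{\mathcal{T}_{\mathcal{A}}}$ is the ideal generated by $\sum_{e\in E(v)}\theta(e)-1$ for all non-leaf vertices $v$ of level $\ge k^*$, and $\Psi_{\mathcal{T}_{\mathcal{A}}}$ is the composition of $\Psi^{\mathsf{toric}}_{\mathcal{T}_{\mathcal{A}}}$ with the quotient map by $\mathfrak{q}_{\mathcal{T}_{\mathcal{A}}}$. A toric ideal is a prime ideal generated by binomials. *)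

theory Defs
  imports
    "Graph_Theory.Graph_Theory"
    "HOL-Library.Poly_Mapping"
    "HOL-Algebra.QuotRing"
begin

section \<open>Staged trees\<close>

text \<open>
  Edges are the arcs of a finite digraph. Since the walk from the root to each vertex is unique,
  no directed walk repeats a vertex, so \<open>awalk\<close> is the notion of directed path here.
\<close>

definition rooted_tree :: "('v, 'e) pre_digraph \<Rightarrow> 'v \<Rightarrow> bool" where
  "rooted_tree G r \<longleftrightarrow>
     fin_digraph G \<and> r \<in> verts G \<and> (\<forall>v\<in>verts G. \<exists>!p. pre_digraph.awalk G r p v)"

definition tree_path :: "('v, 'e) pre_digraph \<Rightarrow> 'v \<Rightarrow> 'v \<Rightarrow> 'e list" where
  "tree_path G u v = (THE p. pre_digraph.awalk G u p v)"

definition level :: "('v, 'e) pre_digraph \<Rightarrow> 'v \<Rightarrow> 'v \<Rightarrow> nat" where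
  "level G r v = length (tree_path G r v)"

definition level_set :: "('v, 'e) pre_digraph \<Rightarrow> 'v \<Rightarrow> nat \<Rightarrow> 'v set" where
  "level_set G r i = {v \<in> verts G. level G r v = i}"

definition leaves :: "('v, 'e) pre_digraph \<Rightarrow> 'v set" where
  "leaves G = {v \<in> verts G. out_arcs G v = {}}"

definition subtree :: "('v, 'e) pre_digraph \<Rightarrow> 'v \<Rightarrow> ('v, 'e) pre_digraph" where
  "subtree G u = G \<restriction> {v. u \<rightarrow>\<^sup>*\<^bsub>G\<^esub> v}"

definition undirected_path_arcs :: "('v, 'e) pre_digraph \<Rightarrow> 'v \<Rightarrow> 'v \<Rightarrow> 'e set" where
  "undirected_path_arcs G u w =
     {e \<in> arcs G. \<exists>p. pre_digraph.apath (with_proj (mk_symmetric G)) u p w \<and>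
        ((tail G e, head G e) \<in> set p \<or> (head G e, tail G e) \<in> set p)}"

definition out_labels :: "('v, 'e) pre_digraph \<Rightarrow> ('e \<Rightarrow> 'l) \<Rightarrow> 'v \<Rightarrow> 'l set" where
  "out_labels G \<theta> v = \<theta> ` out_arcs G v"

definition same_stage :: "('v, 'e) pre_digraph \<Rightarrow> ('e \<Rightarrow> 'l) \<Rightarrow> 'v \<Rightarrow> 'v \<Rightarrow> bool" where
  "same_stage G \<theta> v w \<longleftrightarrow> out_labels G \<theta> v = out_labels G \<theta> w"

text \<open>The label set is the image \<open>\<theta> ` arcs G\<close>, so that labelings are surjective.\<close>

definition staged_tree :: "('v, 'e) pre_digraph \<Rightarrow> 'v \<Rightarrow> ('e \<Rightarrow> 'l) \<Rightarrow> bool" where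
  "staged_tree G r \<theta> \<longleftrightarrow>
     rooted_tree G r \<and>
     (\<forall>v\<in>verts G. card (out_labels G \<theta> v) = card (out_arcs G v)) \<and>
     (\<forall>v\<in>verts G. \<forall>w\<in>verts G.
        out_labels G \<theta> v = out_labels G \<theta> w \<or> out_labels G \<theta> v \<inter> out_labels G \<theta> w = {})"


section \<open>Interventional staged trees\<close>

text \<open>
  \<open>k\<close> is the splitting level, \<open>TL\<close> with root \<open>rL\<close> is the model tree of the subtrees at level \<open>k\<close>,
  and \<open>\<phi> u\<close> is the fixed isomorphism from the subtree at \<open>u\<close> to \<open>TL\<close>. A label \<open>a \<in> A\<close> is
  \<open>a\<^sub>S\<close> for \<open>S = ind a\<close>; the values of \<open>ind\<close> outside \<open>A\<close> are irrelevant.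
\<close>

locale interventional_staged_tree =
  fixes G :: "('v, 'e) pre_digraph" and r :: 'v and \<theta> :: "'e \<Rightarrow> 'l"
    and A L :: "'l set" and k :: nat and ind :: "'l \<Rightarrow> 'w set"
    and TL :: "('w, 'f) pre_digraph" and rL :: 'w
    and \<phi> :: "'v \<Rightarrow> ('v, 'e, 'w, 'f) digraph_isomorphism"
  assumes staged: "staged_tree G r \<theta>"
    and labels_disjoint: "A \<inter> L = {}"
    and labels_surj: "\<theta> ` arcs G = A \<union> L"
    and k_less: "k < Max (level G r ` verts G)"
    and labels_A: "\<theta> ` {e \<in> arcs G. level G r (tail G e) < k} = A"
    and labels_L: "\<theta> ` {e \<in> arcs G. level G r (tail G e) \<ge> k} = L"
    and subtrees_staged: "\<And>u. u \<in> level_set G r k \<Longrightarrow> staged_tree (subtree G u) u \<theta>"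
    and tree_TL: "rooted_tree TL rL"
    and iso: "\<And>u. u \<in> level_set G r k \<Longrightarrow>
      pre_digraph.digraph_isomorphism (subtree G u) (\<phi> u) \<and>
      app_iso (\<phi> u) (subtree G u) = TL \<and> iso_verts (\<phi> u) u = rL"
    and ind_subset: "\<And>a. a \<in> A \<Longrightarrow> ind a \<subseteq> verts TL - {rL}"
    and ind_inj: "inj_on ind A"
    and labels_identified: "\<And>u w e\<^sub>u e\<^sub>w.
      \<lbrakk>u \<in> level_set G r k; w \<in> level_set G r k;
       e\<^sub>u \<in> arcs (subtree G u); e\<^sub>w \<in> arcs (subtree G w);
       iso_arcs (\<phi> u) e\<^sub>u = iso_arcs (\<phi> w) e\<^sub>w\<rbrakk> \<Longrightarrow>
      \<theta> e\<^sub>u = \<theta> e\<^sub>w \<longleftrightarrow>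
        (\<forall>e\<in>undirected_path_arcs G u w. head TL (iso_arcs (\<phi> u) e\<^sub>u) \<notin> ind (\<theta> e))"
    and trivial_stages_above: "\<And>v w.
      \<lbrakk>v \<in> verts G - leaves G; w \<in> verts G - leaves G; level G r v < k; level G r w < k;
       same_stage G \<theta> v w\<rbrakk> \<Longrightarrow> v = w"


section \<open>Polynomial rings\<close>

text \<open>
  Polynomials are finitely supported maps from monomials to coefficients. The indeterminates of a
  ring are given by a set \<open>X\<close>, which need not be the whole type.
\<close>

type_synonym 'x rpoly = "('x \<Rightarrow>\<^sub>0 nat) \<Rightarrow>\<^sub>0 real"

definition PVar :: "'x \<Rightarrow> 'x rpoly" where
  "PVar x = Poly_Mapping.single (Poly_Mapping.single x 1) 1"

definition PConst :: "real \<Rightarrow> 'x rpoly" where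
  "PConst c = Poly_Mapping.single 0 c"

definition poly_indets :: "'x rpoly \<Rightarrow> 'x set" where
  "poly_indets f = (\<Union>m\<in>Poly_Mapping.keys f. Poly_Mapping.keys m)"

definition poly_ring :: "'x set \<Rightarrow> 'x rpoly ring" where
  "poly_ring X = \<lparr>carrier = {f. poly_indets f \<subseteq> X}, mult = (*), one = 1, zero = 0, add = (+)\<rparr>"

text \<open>The homomorphism of real algebras sending each indeterminate \<open>x\<close> to \<open>\<sigma> x\<close>.\<close>

definition poly_subst :: "('x \<Rightarrow> 'y rpoly) \<Rightarrow> 'x rpoly \<Rightarrow> 'y rpoly" where
  "poly_subst \<sigma> f =
     (\<Sum>m\<in>Poly_Mapping.keys f. PConst (Poly_Mapping.lookup f m) *
        (\<Prod>x\<in>Poly_Mapping.keys m. \<sigma> x ^ Poly_Mapping.lookup m x))"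

definition binomial_poly :: "'x rpoly \<Rightarrow> bool" where
  "binomial_poly f \<longleftrightarrow> card (Poly_Mapping.keys f) = 2"

definition toric_ideal :: "'x set \<Rightarrow> 'x rpoly set \<Rightarrow> bool" where
  "toric_ideal X I \<longleftrightarrow>
     primeideal I (poly_ring X) \<and>
     (\<exists>B \<subseteq> carrier (poly_ring X). (\<forall>b\<in>B. binomial_poly b) \<and> I = Idl\<^bsub>poly_ring X\<^esub> B)"


section \<open>Balanced trees\<close>

definition interp_poly :: "('v, 'e) pre_digraph \<Rightarrow> ('e \<Rightarrow> 'l) \<Rightarrow> 'v \<Rightarrow> 'l rpoly" where
  "interp_poly G \<theta> v =
     (\<Sum>p\<in>{p. \<exists>l\<in>leaves G. pre_digraph.awalk G v p l}. \<Prod>e\<leftarrow>p. PVar (\<theta> e))"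

definition balanced_pair :: "('v, 'e) pre_digraph \<Rightarrow> ('e \<Rightarrow> 'l) \<Rightarrow> 'v \<Rightarrow> 'v \<Rightarrow> bool" where
  "balanced_pair G \<theta> v w \<longleftrightarrow>
     (\<forall>e\<in>out_arcs G v. \<forall>e'\<in>out_arcs G v. \<forall>f\<in>out_arcs G w. \<forall>f'\<in>out_arcs G w.
        e \<noteq> e' \<and> \<theta> e = \<theta> f \<and> \<theta> e' = \<theta> f' \<longrightarrow>
        interp_poly G \<theta> (head G e) * interp_poly G \<theta> (head G f') =
        interp_poly G \<theta> (head G f) * interp_poly G \<theta> (head G e'))"

definition balanced :: "('v, 'e) pre_digraph \<Rightarrow> ('e \<Rightarrow> 'l) \<Rightarrow> bool" where
  "balanced G \<theta> \<longleftrightarrow>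
     (\<forall>v\<in>verts G. \<forall>w\<in>verts G. same_stage G \<theta> v w \<longrightarrow> balanced_pair G \<theta> v w)"


section \<open>The maps and their kernels\<close>

text \<open>The pair \<open>(u, l)\<close> stands for the indeterminate \<open>p\<close> with superscript \<open>u\<close> and subscript \<open>l\<close>.\<close>

definition outcome_indets :: "('v, 'e) pre_digraph \<Rightarrow> 'v \<Rightarrow> nat \<Rightarrow> ('v \<times> 'v) set" where
  "outcome_indets G r k = (SIGMA u:level_set G r k. leaves (subtree G u))"

text \<open>\<open>SourceIndet u\<close> stands for \<open>a\<^sub>u\<close>.\<close>

datatype ('v, 'l) param_indet = SourceIndet 'v | LabelIndet 'l

definition param_indets ::
    "('v, 'e) pre_digraph \<Rightarrow> 'v \<Rightarrow> 'l set \<Rightarrow> nat \<Rightarrow> ('v, 'l) param_indet set" where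
  "param_indets G r L k = SourceIndet ` level_set G r k \<union> LabelIndet ` L"

definition psi_toric ::
    "('v, 'e) pre_digraph \<Rightarrow> ('e \<Rightarrow> 'l) \<Rightarrow> ('v \<times> 'v) rpoly \<Rightarrow> ('v, 'l) param_indet rpoly" where
  "psi_toric G \<theta> =
     poly_subst (\<lambda>(u, l). PVar (SourceIndet u) * (\<Prod>e\<leftarrow>tree_path G u l. PVar (LabelIndet (\<theta> e))))"

definition sum_to_one_ideal ::
    "('v, 'e) pre_digraph \<Rightarrow> 'v \<Rightarrow> ('e \<Rightarrow> 'l) \<Rightarrow> 'l set \<Rightarrow> nat \<Rightarrow> ('v, 'l) param_indet rpoly set" where
  "sum_to_one_ideal G r \<theta> L k =
     Idl\<^bsub>poly_ring (param_indets G r L k)\<^esub>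
       {(\<Sum>e\<in>out_arcs G v. PVar (LabelIndet (\<theta> e))) - 1 | v.
          v \<in> verts G - leaves G \<and> level G r v \<ge> k}"

definition psi ::
    "('v, 'e) pre_digraph \<Rightarrow> 'v \<Rightarrow> ('e \<Rightarrow> 'l) \<Rightarrow> 'l set \<Rightarrow> nat \<Rightarrow>
     ('v \<times> 'v) rpoly \<Rightarrow> ('v, 'l) param_indet rpoly set" where
  "psi G r \<theta> L k f =
     sum_to_one_ideal G r \<theta> L k +>\<^bsub>poly_ring (param_indets G r L k)\<^esub> psi_toric G \<theta> f"

definition ker_psi_toric ::
    "('v, 'e) pre_digraph \<Rightarrow> 'v \<Rightarrow> ('e \<Rightarrow> 'l) \<Rightarrow> 'l set \<Rightarrow> nat \<Rightarrow> ('v \<times> 'v) rpoly set" where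
  "ker_psi_toric G r \<theta> L k =
     a_kernel (poly_ring (outcome_indets G r k)) (poly_ring (param_indets G r L k)) (psi_toric G \<theta>)"

definition ker_psi ::
    "('v, 'e) pre_digraph \<Rightarrow> 'v \<Rightarrow> ('e \<Rightarrow> 'l) \<Rightarrow> 'l set \<Rightarrow> nat \<Rightarrow> ('v \<times> 'v) rpoly set" where
  "ker_psi G r \<theta> L k =
     a_kernel (poly_ring (outcome_indets G r k))
       (poly_ring (param_indets G r L k) Quot sum_to_one_ideal G r \<theta> L k) (psi G r \<theta> L k)"

end

theory Submission
  imports Defs "HOL-Computational_Algebra.Polynomial"
begin

text \<open>
  Suppose the tree is balanced. For a positive real point with coordinates \<open>x\<close> and \<open>a\<^sub>u\<close>, write
  \<open>t(v)\<close> for the value of the interpolating polynomial at \<open>v\<close>. Replacing the weight of an edge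
  \<open>v \<rightarrow> w\<close> by \<open>x t(w) / t(v)\<close> and \<open>a\<^sub>u\<close> by \<open>a\<^sub>u t(u)\<close> changes none of the monomials in the image
  of the toric map, and balancedness says precisely that the new weight depends only on the label. The
  new point satisfies all sum-to-one conditions. Hence an element of the image that lies in the
  sum-to-one ideal vanishes at every positive point, so it is zero.

  Conversely, let \<open>p\<^sub>v\<close> be the sum of the outcome variables of the leaves below \<open>v\<close>. Modulo the
  sum-to-one ideal every \<open>t(v)\<close> is \<open>1\<close>, so for \<open>v\<close> and \<open>w\<close> in the same stage
  \<open>p\<^bsub>v i\<^esub> p\<^bsub>w j\<^esub> - p\<^bsub>w i\<^esub> p\<^bsub>v j\<^esub>\<close> lies in the kernel of the quotient map. If it also lies in the toric
  kernel, cancelling a monomial gives the balancing equation.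
\<close>


section \<open>Evaluation of polynomials\<close>

text \<open>Coefficient embeddings, substitutions and evaluations at points are all unital
  homomorphisms between type-class rings, so their compatibility with finite sums and products is
  proved once.\<close>

locale comm_ring_map =
  fixes h :: "'a::comm_ring_1 \<Rightarrow> 'b::comm_ring_1"
  assumes add: "h (a + b) = h a + h b"
    and mult: "h (a * b) = h a * h b"
    and one: "h 1 = 1"
begin

lemma zero: "h 0 = 0"
  using add[of 0 0] by simp

lemma uminus: "h (- a) = - h a"
  using add[of a "- a"] by (simp add: zero eq_neg_iff_add_eq_0 add.commute)

lemma diff: "h (a - b) = h a - h b"
  using add[of a "- b"] by (simp add: uminus)

lemma sum: "h (sum f S) = (\<Sum>i\<in>S. h (f i))"
  by (induction S rule: infinite_finite_induct) (auto simp: zero add)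

lemma prod: "h (prod f S) = (\<Prod>i\<in>S. h (f i))"
  by (induction S rule: infinite_finite_induct) (auto simp: one mult)

lemma power: "h (a ^ n) = h a ^ n"
  by (induction n) (auto simp: one mult)

lemma prod_list: "h (\<Prod>i\<leftarrow>xs. f i) = (\<Prod>i\<leftarrow>xs. h (f i))"
  by (induction xs) (auto simp: one mult)

end

lemma comm_ring_map_id: "comm_ring_map (\<lambda>a. a)"
  by unfold_locales auto

lemma comm_ring_map_PConst: "comm_ring_map PConst"
  by unfold_locales (auto simp: PConst_def single_add mult_single)

definition monom_eval :: "('x \<Rightarrow> 'a::comm_ring_1) \<Rightarrow> ('x \<Rightarrow>\<^sub>0 nat) \<Rightarrow> 'a" where
  "monom_eval \<sigma> m = (\<Prod>x\<in>Poly_Mapping.keys m. \<sigma> x ^ Poly_Mapping.lookup m x)"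

text \<open>The coefficient map \<open>c\<close> is a parameter so that real evaluation,
  substitution of polynomials and passage to univariate polynomials become instances of one
  construction.\<close>

definition poly_eval :: "(real \<Rightarrow> 'a::comm_ring_1) \<Rightarrow> ('x \<Rightarrow> 'a) \<Rightarrow> 'x rpoly \<Rightarrow> 'a" where
  "poly_eval c \<sigma> f =
     (\<Sum>m\<in>Poly_Mapping.keys f. c (Poly_Mapping.lookup f m) * monom_eval \<sigma> m)"

lemma poly_subst_eq_poly_eval: "poly_subst \<sigma> = poly_eval PConst \<sigma>"
  by (simp add: fun_eq_iff poly_subst_def poly_eval_def monom_eval_def)

text \<open>Exponents outside the support are \<open>0\<close> and contribute factors
  \<open>1\<close>. A common index set lets monomials with different supports be multiplied factor
  by factor.\<close>

lemma monom_eval_superset: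
  assumes "finite S" "Poly_Mapping.keys m \<subseteq> S"
  shows "monom_eval \<sigma> m = (\<Prod>x\<in>S. \<sigma> x ^ Poly_Mapping.lookup m x)"
  unfolding monom_eval_def by (intro prod.mono_neutral_left) (use assms in \<open>auto simp: in_keys_iff\<close>)

lemma monom_eval_add: "monom_eval \<sigma> (m + n) = monom_eval \<sigma> m * monom_eval \<sigma> n"
proof -
  let ?S = "Poly_Mapping.keys m \<union> Poly_Mapping.keys n"
  have "Poly_Mapping.keys (m + n) \<subseteq> ?S"
    by (rule Poly_Mapping.keys_add)
  then have "monom_eval \<sigma> (m + n) = (\<Prod>x\<in>?S. \<sigma> x ^ Poly_Mapping.lookup (m + n) x)"
    by (intro monom_eval_superset) auto
  also have "\<dots> = (\<Prod>x\<in>?S. \<sigma> x ^ Poly_Mapping.lookup m x) * (\<Prod>x\<in>?S. \<sigma> x ^ Poly_Mapping.lookup n x)"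
    by (simp add: lookup_add power_add prod.distrib)
  also have "\<dots> = monom_eval \<sigma> m * monom_eval \<sigma> n"
    by (intro arg_cong2[where f = times] monom_eval_superset[symmetric]) auto
  finally show ?thesis .
qed

lemma monom_eval_zero: "monom_eval \<sigma> 0 = 1"
  by (simp add: monom_eval_def)

lemma poly_eval_superset:
  assumes "comm_ring_map c" "finite S" "Poly_Mapping.keys f \<subseteq> S"
  shows "poly_eval c \<sigma> f = (\<Sum>m\<in>S. c (Poly_Mapping.lookup f m) * monom_eval \<sigma> m)"
  unfolding poly_eval_def
  by (intro sum.mono_neutral_left) (use assms in \<open>auto simp: in_keys_iff comm_ring_map.zero\<close>)

lemma poly_eval_add:
  assumes "comm_ring_map c"
  shows "poly_eval c \<sigma> (f + g) = poly_eval c \<sigma> f + poly_eval c \<sigma> g"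
proof -
  let ?S = "Poly_Mapping.keys f \<union> Poly_Mapping.keys g"
  have "Poly_Mapping.keys (f + g) \<subseteq> ?S"
    by (rule Poly_Mapping.keys_add)
  then show ?thesis
    by (subst (1 2 3) poly_eval_superset[OF assms, where S = ?S])
       (auto simp: lookup_add sum.distrib comm_ring_map.add[OF assms] distrib_right)
qed

lemma poly_eval_single:
  assumes "comm_ring_map c"
  shows "poly_eval c \<sigma> (Poly_Mapping.single m a) = c a * monom_eval \<sigma> m"
  by (simp add: poly_eval_def comm_ring_map.zero[OF assms])

lemma poly_eval_sum:
  assumes "comm_ring_map c"
  shows "poly_eval c \<sigma> (sum f S) = (\<Sum>i\<in>S. poly_eval c \<sigma> (f i))"
  by (induction S rule: infinite_finite_induct)
     (auto simp: poly_eval_add[OF assms] poly_eval_def[of _ _ 0])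

lemma poly_mapping_sum_singles:
  fixes f :: "'a \<Rightarrow>\<^sub>0 'b::comm_monoid_add"
  shows "f = (\<Sum>m\<in>Poly_Mapping.keys f. Poly_Mapping.single m (Poly_Mapping.lookup f m))"
  by (rule poly_mapping_eqI) (auto simp: lookup_sum lookup_single when_def in_keys_iff)

lemma poly_eval_mult:
  assumes "comm_ring_map c"
  shows "poly_eval c \<sigma> (f * g) = poly_eval c \<sigma> f * poly_eval c \<sigma> g"
proof -
  let ?s = "\<lambda>p m. Poly_Mapping.single m (Poly_Mapping.lookup p m)"
  have "f * g = (\<Sum>m\<in>Poly_Mapping.keys f. \<Sum>n\<in>Poly_Mapping.keys g. ?s f m * ?s g n)"
    by (subst (1) poly_mapping_sum_singles[of f], subst (1) poly_mapping_sum_singles[of g])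
       (simp add: sum_product)
  then have "poly_eval c \<sigma> (f * g) =
      (\<Sum>m\<in>Poly_Mapping.keys f. \<Sum>n\<in>Poly_Mapping.keys g.
         c (Poly_Mapping.lookup f m) * monom_eval \<sigma> m * (c (Poly_Mapping.lookup g n) * monom_eval \<sigma> n))"
    by (simp add: poly_eval_sum[OF assms] mult_single poly_eval_single[OF assms] monom_eval_add
        comm_ring_map.mult[OF assms] mult_ac)
  then show ?thesis
    by (simp add: poly_eval_def sum_product)
qed

lemma comm_ring_map_poly_eval:
  assumes "comm_ring_map c"
  shows "comm_ring_map (poly_eval c \<sigma>)"
proof
  show "poly_eval c \<sigma> 1 = 1"
    using poly_eval_single[OF assms, of \<sigma> 0 1]
    by (simp add: monom_eval_zero comm_ring_map.one[OF assms])
qed (auto simp: poly_eval_add poly_eval_mult assms)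

lemma poly_eval_PVar:
  assumes "comm_ring_map c"
  shows "poly_eval c \<sigma> (PVar x) = \<sigma> x"
  by (simp add: PVar_def poly_eval_single[OF assms] comm_ring_map.one[OF assms] monom_eval_def)

lemma poly_eval_cong:
  assumes "\<And>x. x \<in> poly_indets f \<Longrightarrow> \<sigma> x = \<tau> x"
  shows "poly_eval c \<sigma> f = poly_eval c \<tau> f"
  unfolding poly_eval_def monom_eval_def
  by (intro sum.cong refl arg_cong2[where f = times] prod.cong arg_cong2[where f = power] assms)
     (auto simp: poly_indets_def)

text \<open>Applying a homomorphism after an evaluation amounts to evaluating at the image point.
  This serves to evaluate a substituted polynomial and to evaluate \<open>weight_poly\<close> at a
  real number.\<close>

lemma ring_map_poly_eval:
  assumes "comm_ring_map h" "\<And>a. h (c a) = d a"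
  shows "h (poly_eval c \<sigma> f) = poly_eval d (\<lambda>x. h (\<sigma> x)) f"
  unfolding poly_eval_def monom_eval_def
  by (simp add: assms(2) comm_ring_map.sum[OF assms(1)] comm_ring_map.mult[OF assms(1)]
      comm_ring_map.prod[OF assms(1)] comm_ring_map.power[OF assms(1)])

abbreviation real_eval :: "('x \<Rightarrow> real) \<Rightarrow> 'x rpoly \<Rightarrow> real" where
  "real_eval \<equiv> poly_eval (\<lambda>a. a)"

interpretation real_eval: comm_ring_map "real_eval y" for y :: "'x \<Rightarrow> real"
  by (intro comm_ring_map_poly_eval comm_ring_map_id)

lemma real_eval_PVar: "real_eval y (PVar x) = y x"
  by (intro poly_eval_PVar comm_ring_map_id)

lemma real_eval_poly_subst:
  "real_eval y (poly_subst \<sigma> f) = real_eval (\<lambda>x. real_eval y (\<sigma> x)) f"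
  unfolding poly_subst_eq_poly_eval
  by (rule ring_map_poly_eval[where h = "real_eval y", OF real_eval.comm_ring_map_axioms])
     (simp add: PConst_def poly_eval_single[OF comm_ring_map_id] monom_eval_zero)


section \<open>Separating monomials by weights\<close>

text \<open>Kronecker substitution: reading the exponents as digits in a large base.\<close>

lemma separating_weight_fun:
  fixes S :: "('x \<Rightarrow> nat) set"
  assumes "finite X" "finite S"
  shows "\<exists>w::'x \<Rightarrow> nat. \<forall>f\<in>S. \<forall>g\<in>S.
           (\<Sum>x\<in>X. w x * f x) = (\<Sum>x\<in>X. w x * g x) \<longrightarrow> (\<forall>x\<in>X. f x = g x)"
  using assms(1)
proof (induction X)
  case (insert a X)
  then obtain w :: "'x \<Rightarrow> nat" where w: "\<And>f g. f \<in> S \<Longrightarrow> g \<in> S \<Longrightarrow>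
      (\<Sum>x\<in>X. w x * f x) = (\<Sum>x\<in>X. w x * g x) \<Longrightarrow> (\<forall>x\<in>X. f x = g x)"
    by blast
  \<comment> \<open>Every value \<open>f a\<close> with \<open>f\<close> in \<open>S\<close> is
    below \<open>N\<close>, so it can serve as a digit in base \<open>N\<close>.\<close>
  define N where "N = Suc (Max ((\<lambda>f. f a) ` S))"
  have N: "f a < N" if "f \<in> S" for f
    using that assms(2) by (auto simp: N_def less_Suc_eq_le intro!: Max_ge)
  \<comment> \<open>The value at \<open>a\<close> becomes the lowest digit, and the weighted sum
    over \<open>X\<close> moves up by one place.\<close>
  define w' where "w' = (\<lambda>x. if x = a then 1 else N * w x)"
  have w': "(\<Sum>x\<in>insert a X. w' x * f x) = f a + N * (\<Sum>x\<in>X. w x * f x)" for f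
  proof -
    have "(\<Sum>x\<in>X. w' x * f x) = (\<Sum>x\<in>X. N * (w x * f x))"
      by (rule sum.cong) (use insert.hyps in \<open>auto simp: w'_def\<close>)
    then show ?thesis
      using insert.hyps by (simp add: sum_distrib_left w'_def)
  qed
  show ?case
  proof (intro exI[of _ w'] ballI impI)
    fix f g x
    assume fg: "f \<in> S" "g \<in> S" and x: "x \<in> insert a X"
      and "(\<Sum>x\<in>insert a X. w' x * f x) = (\<Sum>x\<in>insert a X. w' x * g x)"
    then have eq: "f a + N * (\<Sum>x\<in>X. w x * f x) = g a + N * (\<Sum>x\<in>X. w x * g x)"
      by (simp only: w')
    from arg_cong[OF this, of "\<lambda>n. n mod N"] have "f a = g a"
      using N fg by simp
    moreover from this eq have "(\<Sum>x\<in>X. w x * f x) = (\<Sum>x\<in>X. w x * g x)"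
      using N[OF fg(1)] by auto
    ultimately show "f x = g x"
      using w[OF fg] x by auto
  qed
qed auto

definition weight :: "('x \<Rightarrow> nat) \<Rightarrow> ('x \<Rightarrow>\<^sub>0 nat) \<Rightarrow> nat" where
  "weight w m = (\<Sum>x\<in>Poly_Mapping.keys m. w x * Poly_Mapping.lookup m x)"

text \<open>Only finitely many indeterminates occur in \<open>S\<close>; outside them all exponents
  are \<open>0\<close>, so agreement on them suffices.\<close>

lemma separating_weight:
  fixes S :: "('x \<Rightarrow>\<^sub>0 nat) set"
  assumes "finite S"
  shows "\<exists>w. inj_on (weight w) S"
proof -
  define X where "X = \<Union> (Poly_Mapping.keys ` S)"
  have X: "finite X"
    using assms by (auto simp: X_def)
  obtain w :: "'x \<Rightarrow> nat" where
    w: "\<forall>f\<in>Poly_Mapping.lookup ` S. \<forall>g\<in>Poly_Mapping.lookup ` S.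
          (\<Sum>x\<in>X. w x * f x) = (\<Sum>x\<in>X. w x * g x) \<longrightarrow> (\<forall>x\<in>X. f x = g x)"
    using separating_weight_fun[OF X, of "Poly_Mapping.lookup ` S"] assms by blast
  have weight: "weight w m = (\<Sum>x\<in>X. w x * Poly_Mapping.lookup m x)" if "m \<in> S" for m
    unfolding weight_def
    by (rule sum.mono_neutral_left) (use X that in \<open>auto simp: in_keys_iff X_def\<close>)
  have "inj_on (weight w) S"
  proof (intro inj_onI poly_mapping_eqI)
    fix m n x
    assume mn: "m \<in> S" "n \<in> S" "weight w m = weight w n"
    show "Poly_Mapping.lookup m x = Poly_Mapping.lookup n x"
    proof (cases "x \<in> X")
      case True
      then show ?thesis
        using w[rule_format, OF imageI[OF mn(1)] imageI[OF mn(2)]] mn(3) weight[OF mn(1)] weight[OF mn(2)]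
        by simp
    next
      case False
      then show ?thesis
        using mn(1,2) by (auto simp: X_def in_keys_iff)
    qed
  qed
  then show ?thesis
    by blast
qed

text \<open>The restriction of a polynomial to the curve whose coordinates are the powers
  \<open>t ^ w x\<close>, read as a univariate polynomial in \<open>t\<close>.\<close>

definition weight_poly :: "('x \<Rightarrow> nat) \<Rightarrow> 'x rpoly \<Rightarrow> real poly" where
  "weight_poly w = poly_eval (\<lambda>a. [:a:]) (\<lambda>x. monom 1 (w x))"

lemma comm_ring_map_const_poly: "comm_ring_map (\<lambda>a::real. [:a:])"
  by unfold_locales auto

lemma weight_poly_altdef:
  "weight_poly w f =
     (\<Sum>m\<in>Poly_Mapping.keys f. monom (Poly_Mapping.lookup f m) (weight w m))"
proof -
  have prod_monom: "(\<Prod>x\<in>S. monom (1::real) (g x)) = monom 1 (sum g S)" for S :: "'a set" and g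
    by (induction S rule: infinite_finite_induct) (auto simp: mult_monom one_pCons monom_0)
  show ?thesis
    by (simp add: weight_poly_def poly_eval_def monom_eval_def weight_def monom_power smult_monom
        prod_monom)
qed

text \<open>Injectivity of the weight keeps the monomials of \<open>f\<close> apart: the coefficient
  at \<open>weight w m\<close> is exactly that of \<open>m\<close>.\<close>

lemma weight_poly_nonzero:
  assumes "inj_on (weight w) (Poly_Mapping.keys f)" "f \<noteq> 0"
  shows "weight_poly w f \<noteq> 0"
proof
  assume 0: "weight_poly w f = 0"
  obtain m where m: "m \<in> Poly_Mapping.keys f"
    using assms(2) by fastforce
  have "0 = coeff (weight_poly w f) (weight w m)"
    using 0 by simp
  also have "\<dots> = (\<Sum>n\<in>Poly_Mapping.keys f. if n = m then Poly_Mapping.lookup f n else 0)"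
    unfolding weight_poly_altdef coeff_sum
    by (rule sum.cong) (use assms(1) m in \<open>auto simp: inj_on_def\<close>)
  also have "\<dots> = Poly_Mapping.lookup f m"
    using m by simp
  finally show False
    using m by (simp add: in_keys_iff)
qed

text \<open>One weight separates the supports of both factors, so nonzero factors have nonzero
  images in the integral domain of univariate real polynomials.\<close>

lemma rpoly_mult_eq_0_iff:
  fixes f g :: "'x rpoly"
  shows "f * g = 0 \<longleftrightarrow> f = 0 \<or> g = 0"
proof
  assume fg: "f * g = 0"
  obtain w where w: "inj_on (weight w) (Poly_Mapping.keys f \<union> Poly_Mapping.keys g)"
    using separating_weight[of "Poly_Mapping.keys f \<union> Poly_Mapping.keys g"] by auto
  have "weight_poly w f * weight_poly w g = 0"
    using poly_eval_mult[OF comm_ring_map_const_poly, of "\<lambda>x. monom 1 (w x)" f g] fg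
    by (simp add: weight_poly_def poly_eval_def[of _ _ 0])
  then show "f = 0 \<or> g = 0"
    using weight_poly_nonzero inj_on_subset[OF w] by (metis mult_eq_0_iff sup_ge1 sup_ge2)
qed auto

lemma poly_weight_poly: "poly (weight_poly w f) t = real_eval (\<lambda>x. t ^ w x) f"
proof -
  have "comm_ring_map (\<lambda>p. poly p t)"
    by unfold_locales auto
  from ring_map_poly_eval[OF this, of "\<lambda>a. [:a:]" "\<lambda>a. a" "\<lambda>x. monom 1 (w x)" f]
  show ?thesis
    by (simp add: weight_poly_def poly_monom)
qed

text \<open>For \<open>t > 0\<close> the curve with coordinates \<open>t ^ w x\<close> consists of
  positive points. A nonzero \<open>f\<close> would restrict to a nonzero univariate polynomial with
  infinitely many roots.\<close>

lemma rpoly_eq_0_if_vanishes_on_positives: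
  fixes f :: "'x rpoly"
  assumes "\<And>y. (\<And>x. y x > 0) \<Longrightarrow> real_eval y f = 0"
  shows "f = 0"
proof (rule ccontr)
  assume f: "f \<noteq> 0"
  obtain w where w: "inj_on (weight w) (Poly_Mapping.keys f)"
    using separating_weight[OF finite_keys] by blast
  have "poly (weight_poly w f) t = 0" if "t > 0" for t
    unfolding poly_weight_poly by (rule assms) (use that in simp)
  then have "{0<..} \<subseteq> {t. poly (weight_poly w f) t = 0}"
    by auto
  moreover have "finite {t. poly (weight_poly w f) t = 0}"
    by (rule poly_roots_finite[OF weight_poly_nonzero[OF w f]])
  ultimately show False
    using infinite_Ioi[of "0::real"] finite_subset by blast
qed


section \<open>Polynomial rings and monomial maps\<close>

lemma poly_ring_simps [simp]:
  "carrier (poly_ring X) = {f. poly_indets f \<subseteq> X}" "x \<otimes>\<^bsub>poly_ring X\<^esub> y = x * y"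
  "\<one>\<^bsub>poly_ring X\<^esub> = 1" "\<zero>\<^bsub>poly_ring X\<^esub> = 0" "x \<oplus>\<^bsub>poly_ring X\<^esub> y = x + y"
  by (simp_all add: poly_ring_def)

lemma poly_indets_subset_iff:
  "poly_indets f \<subseteq> X \<longleftrightarrow> (\<forall>m\<in>Poly_Mapping.keys f. Poly_Mapping.keys m \<subseteq> X)"
  by (auto simp: poly_indets_def)

lemma poly_indets_zero [simp]: "poly_indets 0 = {}"
  and poly_indets_one [simp]: "poly_indets 1 = {}"
  and poly_indets_PVar [simp]: "poly_indets (PVar x) = {x}"
  and poly_indets_PConst: "poly_indets (PConst c) = {}"
  and poly_indets_uminus [simp]: "poly_indets (- f) = poly_indets f"
proof -
  have "Poly_Mapping.keys (- f) = Poly_Mapping.keys f"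
    by (auto simp: in_keys_iff)
  then show "poly_indets (- f) = poly_indets f"
    by (simp add: poly_indets_def)
qed (auto simp: poly_indets_def PVar_def PConst_def)

lemma poly_indets_add:
  "poly_indets f \<subseteq> X \<Longrightarrow> poly_indets g \<subseteq> X \<Longrightarrow> poly_indets (f + g) \<subseteq> X"
  using Poly_Mapping.keys_add[of f g] unfolding poly_indets_subset_iff by blast

lemma poly_indets_diff:
  "poly_indets f \<subseteq> X \<Longrightarrow> poly_indets g \<subseteq> X \<Longrightarrow> poly_indets (f - g) \<subseteq> X"
  using poly_indets_add[of f X "- g"] by simp

lemma poly_indets_mult:
  assumes "poly_indets f \<subseteq> X" "poly_indets g \<subseteq> X"
  shows "poly_indets (f * g) \<subseteq> X"
  unfolding poly_indets_subset_iff
proof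
  fix m assume "m \<in> Poly_Mapping.keys (f * g)"
  then obtain a b where ab: "a \<in> Poly_Mapping.keys f" "b \<in> Poly_Mapping.keys g" "m = a + b"
    using keys_mult[of f g] by auto
  then show "Poly_Mapping.keys m \<subseteq> X"
    using assms Poly_Mapping.keys_add[of a b] unfolding poly_indets_subset_iff by blast
qed

lemma poly_indets_sum:
  "(\<And>i. i \<in> S \<Longrightarrow> poly_indets (f i) \<subseteq> X) \<Longrightarrow> poly_indets (sum f S) \<subseteq> X"
  by (induction S rule: infinite_finite_induct) (simp_all add: poly_indets_add)

lemma poly_indets_prod:
  "(\<And>i. i \<in> S \<Longrightarrow> poly_indets (f i) \<subseteq> X) \<Longrightarrow> poly_indets (prod f S) \<subseteq> X"
  by (induction S rule: infinite_finite_induct) (simp_all add: poly_indets_mult)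

lemma poly_indets_power: "poly_indets f \<subseteq> X \<Longrightarrow> poly_indets (f ^ n) \<subseteq> X"
  by (induction n) (simp_all add: poly_indets_mult)

lemma poly_indets_prod_list:
  "(\<And>i. i \<in> set xs \<Longrightarrow> poly_indets (f i) \<subseteq> X) \<Longrightarrow> poly_indets (\<Prod>i\<leftarrow>xs. f i) \<subseteq> X"
  by (induction xs) (simp_all add: poly_indets_mult)

lemma poly_indets_poly_subst:
  assumes "poly_indets f \<subseteq> X" "\<And>x. x \<in> X \<Longrightarrow> poly_indets (\<sigma> x) \<subseteq> Y"
  shows "poly_indets (poly_subst \<sigma> f) \<subseteq> Y"
  unfolding poly_subst_def
  by (intro poly_indets_sum poly_indets_mult poly_indets_prod poly_indets_power assms(2))
     (use assms(1) in \<open>auto simp: poly_indets_PConst poly_indets_subset_iff\<close>)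

lemma cring_poly_ring: "cring (poly_ring X)"
proof (intro cringI abelian_groupI comm_monoidI)
  fix x assume "x \<in> carrier (poly_ring X)"
  then show "\<exists>y\<in>carrier (poly_ring X). y \<oplus>\<^bsub>poly_ring X\<^esub> x = \<zero>\<^bsub>poly_ring X\<^esub>"
    by (intro bexI[of _ "- x"]) auto
qed (simp_all add: poly_indets_add poly_indets_mult algebra_simps)

section \<open>Ideals of polynomial rings\<close>

lemma idealI_poly_ring:
  assumes "I \<subseteq> {f. poly_indets f \<subseteq> X}" "0 \<in> I"
    and add: "\<And>f g. f \<in> I \<Longrightarrow> g \<in> I \<Longrightarrow> f + g \<in> I"
    and mult: "\<And>f g. f \<in> I \<Longrightarrow> poly_indets g \<subseteq> X \<Longrightarrow> g * f \<in> I"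
  shows "ideal I (poly_ring X)"
proof -
  interpret cring "poly_ring X"
    by (rule cring_poly_ring)
  have uminus: "- f \<in> I" if "f \<in> I" for f
    using mult[OF that, of "- 1"] by simp
  have inv: "\<ominus>\<^bsub>poly_ring X\<^esub> f = - f" if "f \<in> I" for f
    using minus_equality[of "- f" f] that assms(1) by auto
  show ?thesis
  proof (rule idealI[OF ring_axioms])
    show "subgroup I (add_monoid (poly_ring X))"
    proof (rule add.subgroupI)
      show "I \<subseteq> carrier (poly_ring X)"
        using assms(1) by simp
    qed (use assms(2) add uminus inv in \<open>auto simp: a_inv_def[symmetric]\<close>)
  qed (use mult in \<open>auto simp: mult.commute\<close>)
qed

text \<open>Translates the closure properties of an ideal from the structure
  \<open>poly_ring X\<close> into the ordinary operations on polynomials.\<close>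

locale poly_ideal =
  fixes X :: "'x set" and I :: "'x rpoly set"
  assumes ideal: "ideal I (poly_ring X)"
begin

lemma indets: "f \<in> I \<Longrightarrow> poly_indets f \<subseteq> X"
  using ideal.Icarr[OF ideal, of f] by simp

lemma add: "f \<in> I \<Longrightarrow> g \<in> I \<Longrightarrow> f + g \<in> I"
  using additive_subgroup.a_closed[OF ideal.axioms(1)[OF ideal]] by simp

lemma mult: "f \<in> I \<Longrightarrow> poly_indets g \<subseteq> X \<Longrightarrow> g * f \<in> I"
  using ideal.I_l_closed[OF ideal, of f g] by simp

lemma zero: "0 \<in> I"
  using additive_subgroup.zero_closed[OF ideal.axioms(1)[OF ideal]] by simp

lemma uminus: "f \<in> I \<Longrightarrow> - f \<in> I"
  using mult[of f "- 1"] by simp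

lemma diff: "f \<in> I \<Longrightarrow> g \<in> I \<Longrightarrow> f - g \<in> I"
  using add[OF _ uminus, of f g] by simp

lemma sum: "(\<And>i. i \<in> S \<Longrightarrow> f i \<in> I) \<Longrightarrow> sum f S \<in> I"
  by (induction S rule: infinite_finite_induct) (auto simp: zero intro!: add)

end

lemma ideal_real_eval_vanishing:
  "ideal {f. poly_indets f \<subseteq> X \<and> real_eval y f = 0} (poly_ring X)"
  by (rule idealI_poly_ring)
     (simp_all add: real_eval.zero real_eval.add real_eval.mult poly_indets_add poly_indets_mult Collect_mono)

section \<open>Kernels of monomial substitutions\<close>

interpretation poly_subst: comm_ring_map "poly_subst \<sigma>" for \<sigma> :: "'x \<Rightarrow> 'y rpoly"
  unfolding poly_subst_eq_poly_eval by (intro comm_ring_map_poly_eval comm_ring_map_PConst)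

lemma poly_subst_PVar: "poly_subst \<sigma> (PVar x) = \<sigma> x"
  unfolding poly_subst_eq_poly_eval by (intro poly_eval_PVar comm_ring_map_PConst)

definition monomial_map :: "('x \<Rightarrow> 'y rpoly) \<Rightarrow> bool" where
  "monomial_map \<sigma> \<longleftrightarrow> (\<forall>x. \<exists>m. \<sigma> x = Poly_Mapping.single m 1)"

lemma monom_eval_monomial_map:
  fixes \<sigma> :: "'x \<Rightarrow> 'y rpoly"
  assumes "monomial_map \<sigma>"
  shows "\<exists>n. monom_eval \<sigma> m = Poly_Mapping.single n 1"
proof -
  have prod: "\<exists>n. prod f S = Poly_Mapping.single n 1"
    if "\<And>i. i \<in> S \<Longrightarrow> \<exists>n. f i = Poly_Mapping.single n 1" for f :: "'x \<Rightarrow> 'y rpoly" and S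
    using that
  proof (induction S rule: infinite_finite_induct)
    case (insert a S)
    then obtain m n where "f a = Poly_Mapping.single m 1" "prod f S = Poly_Mapping.single n 1"
      by blast
    then show ?case
      using insert.hyps by (auto simp: mult_single)
  qed (auto intro!: exI[of _ 0])
  have power: "\<exists>n. \<sigma> x ^ j = Poly_Mapping.single n 1" for x j
  proof (induction j)
    case (Suc j)
    then obtain n where n: "\<sigma> x ^ j = Poly_Mapping.single n 1"
      by blast
    obtain m where "\<sigma> x = Poly_Mapping.single m 1"
      using assms by (auto simp: monomial_map_def)
    with n show ?case
      by (auto simp: mult_single)
  qed (auto intro!: exI[of _ 0])
  show ?thesis
    unfolding monom_eval_def by (intro prod power)
qed

text \<open>Primality comes from the absence of zero divisors in the target. Binomial generation
  comes by induction on the number of terms, because coefficients of a kernel element must cancel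
  among monomials with the same image.\<close>

lemma kernel_poly_subst_toric:
  fixes \<sigma> :: "'x \<Rightarrow> 'y rpoly"
  assumes "monomial_map \<sigma>"
  shows "toric_ideal X {f. poly_indets f \<subseteq> X \<and> poly_subst \<sigma> f = 0}" (is "toric_ideal X ?K")
proof -
  interpret cring "poly_ring X"
    by (rule cring_poly_ring)
  have K: "ideal ?K (poly_ring X)"
    by (rule idealI_poly_ring)
       (simp_all add: poly_subst.zero poly_subst.add poly_subst.mult poly_indets_add poly_indets_mult
          Collect_mono)
  have "1 \<notin> ?K"
    by (simp add: poly_subst.one)
  then have "carrier (poly_ring X) \<noteq> ?K"
    using one_closed by auto
  then have prime: "primeideal ?K (poly_ring X)"
    by (intro primeidealI[OF K cring_axioms])
       (auto simp: poly_subst.mult rpoly_mult_eq_0_iff)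
  obtain \<mu> where \<mu>: "\<And>m. monom_eval \<sigma> m = Poly_Mapping.single (\<mu> m) 1"
    using monom_eval_monomial_map[OF assms] by metis
  have subst_single: "poly_subst \<sigma> (Poly_Mapping.single m c) = Poly_Mapping.single (\<mu> m) c" for m c
    by (simp add: poly_subst_eq_poly_eval poly_eval_single[OF comm_ring_map_PConst] \<mu> PConst_def
        mult_single)
  have subst: "poly_subst \<sigma> f =
      (\<Sum>m\<in>Poly_Mapping.keys f. Poly_Mapping.single (\<mu> m) (Poly_Mapping.lookup f m))" for f
    unfolding subst_single[symmetric] poly_subst.sum[symmetric]
    by (subst (1) poly_mapping_sum_singles[of f]) (rule refl)
  define B where "B = {b \<in> ?K. binomial_poly b}"
  have BK: "B \<subseteq> ?K"
    by (auto simp: B_def)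
  interpret BI: poly_ideal X "Idl\<^bsub>poly_ring X\<^esub> B"
    by (intro poly_ideal.intro genideal_ideal) (use BK in auto)
  \<comment> \<open>In a kernel element every monomial shares its image with another one; subtracting a multiple
    of the difference of the two removes the first from the support.\<close>
  have "f \<in> Idl\<^bsub>poly_ring X\<^esub> B" if "f \<in> ?K" for f
    using that
  proof (induction "card (Poly_Mapping.keys f)" arbitrary: f rule: less_induct)
    case less
    show ?case
    proof (cases "f = 0")
      case False
      then obtain m where m: "m \<in> Poly_Mapping.keys f"
        by fastforce
      define c where "c = Poly_Mapping.lookup f m"
      have c: "c \<noteq> 0"
        using m by (simp add: c_def in_keys_iff)
      \<comment> \<open>If no other monomial of \<open>f\<close> had the image
        \<open>\<mu> m\<close>, the image of \<open>f\<close> would have the nonzero coefficient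
        \<open>c\<close> there.\<close>
      have "\<exists>n\<in>Poly_Mapping.keys f. n \<noteq> m \<and> \<mu> n = \<mu> m"
      proof (rule ccontr)
        assume "\<not> ?thesis"
        then have "(\<Sum>n\<in>Poly_Mapping.keys f. if \<mu> n = \<mu> m then Poly_Mapping.lookup f n else 0) =
            (\<Sum>n\<in>Poly_Mapping.keys f. if n = m then Poly_Mapping.lookup f n else 0)"
          by (intro sum.cong) auto
        moreover have "Poly_Mapping.lookup (poly_subst \<sigma> f) (\<mu> m) = 
            (\<Sum>n\<in>Poly_Mapping.keys f. if \<mu> n = \<mu> m then Poly_Mapping.lookup f n else 0)"
          by (simp add: subst lookup_sum lookup_single when_def)
        ultimately show False
          using less.prems m c by (simp add: c_def)
      qed
      then obtain n where n: "n \<in> Poly_Mapping.keys f" "n \<noteq> m" "\<mu> n = \<mu> m"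
        by blast
      define b :: "'x rpoly" where "b = Poly_Mapping.single m c - Poly_Mapping.single n c"
      have keys_b: "Poly_Mapping.keys b = {m, n}"
        using n(2) c by (auto simp: b_def in_keys_iff lookup_minus lookup_single when_def split: if_splits)
      have indets_b: "poly_indets b \<subseteq> X"
        using less.prems m n(1) unfolding poly_indets_subset_iff keys_b by blast
      have b: "b \<in> B"
        using indets_b n by (simp add: B_def binomial_poly_def keys_b)
          (simp add: b_def poly_subst.diff subst_single)
      have lookup_fb: "Poly_Mapping.lookup (f - b) m = 0"
        using n(2) by (simp add: b_def c_def lookup_minus lookup_single when_def)
      have "Poly_Mapping.keys (f - b) \<subseteq> Poly_Mapping.keys f - {m}"
      proof
        fix x assume x: "x \<in> Poly_Mapping.keys (f - b)"
        then have "x \<noteq> m"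
          using lookup_fb by (auto simp: in_keys_iff)
        moreover have "x \<in> Poly_Mapping.keys f \<union> Poly_Mapping.keys b"
          using x by (auto simp: in_keys_iff lookup_minus)
        ultimately show "x \<in> Poly_Mapping.keys f - {m}"
          using keys_b n(1) by auto
      qed
      then have "card (Poly_Mapping.keys (f - b)) < card (Poly_Mapping.keys f)"
        using m by (metis card_Diff1_less card_mono finite_Diff finite_keys order_le_less_trans)
      moreover have "f - b \<in> ?K"
        using less.prems subsetD[OF BK b] by (simp add: poly_subst.diff poly_indets_diff)
      ultimately have "f - b \<in> Idl\<^bsub>poly_ring X\<^esub> B"
        by (rule less.hyps)
      moreover have "b \<in> Idl\<^bsub>poly_ring X\<^esub> B"
        using genideal_self[of B] b BK by auto
      ultimately have "(f - b) + b \<in> Idl\<^bsub>poly_ring X\<^esub> B"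
        by (rule BI.add)
      then show ?thesis
        by simp
    qed (simp add: BI.zero)
  qed
  then have "?K \<subseteq> Idl\<^bsub>poly_ring X\<^esub> B"
    by blast
  moreover have "Idl\<^bsub>poly_ring X\<^esub> B \<subseteq> ?K"
    using genideal_minimal[OF K] BK by blast
  ultimately have "?K = Idl\<^bsub>poly_ring X\<^esub> B"
    by (rule equalityI)
  moreover have "B \<subseteq> carrier (poly_ring X)" "\<forall>b\<in>B. binomial_poly b"
    using BK by (auto simp: B_def)
  ultimately show ?thesis
    unfolding toric_ideal_def using prime by blast
qed


section \<open>Walks in rooted trees\<close>

locale finite_rooted_tree = fin_digraph G for G :: "('v, 'e) pre_digraph" +
  fixes r :: 'v
  assumes root_in_verts: "r \<in> verts G"
    and ex1_awalk: "v \<in> verts G \<Longrightarrow> \<exists>!p. awalk r p v"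
begin

text \<open>Prepending the walk from the root to \<open>u\<close> reduces this to uniqueness of
  walks from the root.\<close>

lemma awalk_unique:
  assumes "awalk u p v" "awalk u q v"
  shows "p = q"
proof -
  obtain s where s: "awalk r s u"
    using ex1_awalk[of u] assms(1) by (auto dest: awalk_hd_in_verts)
  then have "awalk r (s @ p) v" "awalk r (s @ q) v"
    using assms by (blast intro: awalk_appendI)+
  then have "s @ p = s @ q"
    using ex1_awalk[OF awalk_last_in_verts[OF assms(1)]] by blast
  then show ?thesis
    by simp
qed

lemma tree_path_eq: "awalk u p v \<Longrightarrow> tree_path G u v = p"
  unfolding tree_path_def by (blast intro: the_equality awalk_unique)

lemma level_awalk:
  assumes "awalk u p v"
  shows "level G r v = level G r u + length p"
proof -
  obtain s where s: "awalk r s u"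
    using ex1_awalk[of u] assms by (auto dest: awalk_hd_in_verts)
  then have "awalk r (s @ p) v"
    using assms by (rule awalk_appendI)
  from tree_path_eq[OF this] tree_path_eq[OF s] show ?thesis
    by (simp add: level_def)
qed

lemma arc_awalk: "e \<in> arcs G \<Longrightarrow> awalk (tail G e) [e] (head G e)"
  by (simp add: arc_implies_awalk)

lemma level_head: "e \<in> arcs G \<Longrightarrow> level G r (head G e) = Suc (level G r (tail G e))"
  using level_awalk[OF arc_awalk] by simp

text \<open>Arcs raise the level by one and levels are bounded in a finite tree, so properties can
  be propagated from the leaves towards the root.\<close>

lemma descending_induct [consumes 1, case_names step]:
  assumes "v \<in> verts G"
    and step: "\<And>v. v \<in> verts G \<Longrightarrow> (\<And>e. e \<in> out_arcs G v \<Longrightarrow> P (head G e)) \<Longrightarrow> P v"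
  shows "P v"
  using assms(1)
proof (induction "Max (level G r ` verts G) - level G r v" arbitrary: v rule: less_induct)
  case less
  show ?case
  proof (rule step[OF less.prems])
    fix e assume e: "e \<in> out_arcs G v"
    then have he: "head G e \<in> verts G" "level G r (head G e) = Suc (level G r v)"
      using level_head[of e] by auto
    moreover have "level G r (head G e) \<le> Max (level G r ` verts G)"
      using he(1) by (intro Max_ge) auto
    ultimately show "P (head G e)"
      by (intro less.hyps) auto
  qed
qed

text \<open>The vertex \<open>u\<close> is the one reached after the first \<open>k\<close> arcs of
  the walk from the root to \<open>v\<close>.\<close>

lemma ancestor_at_level:
  assumes "v \<in> verts G" "k \<le> level G r v"
  obtains u p where "u \<in> level_set G r k" "awalk u p v"
proof -
  obtain s where s: "awalk r s v"
    using ex1_awalk[OF assms(1)] by blast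
  have len: "k \<le> length s"
    using assms(2) s by (simp add: level_def tree_path_eq)
  have "awalk r (take k s @ drop k s) v"
    using s by simp
  then have *: "awalk r (take k s) (awlast r (take k s))" "awalk (awlast r (take k s)) (drop k s) v"
    unfolding awalk_append_iff by auto
  moreover have "level G r (awlast r (take k s)) = k"
    using tree_path_eq[OF *(1)] len by (simp add: level_def)
  ultimately show ?thesis
    by (intro that[of "awlast r (take k s)" "drop k s"]) (auto simp: level_set_def)
qed

section \<open>Walks to leaves and interpolating polynomials\<close>

definition leaf_walks :: "'v \<Rightarrow> 'e list set" where
  "leaf_walks v = {p. \<exists>l\<in>leaves G. awalk v p l}"

lemma finite_leaf_walks: "finite (leaf_walks v)"
proof -
  have "leaf_walks v \<subseteq> tree_path G v ` leaves G"
    by (auto simp: leaf_walks_def intro: tree_path_eq[symmetric])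
  moreover have "finite (leaves G)"
    by (simp add: leaves_def)
  ultimately show ?thesis
    using finite_surj by blast
qed

lemma leaf_walks_leaf: "v \<in> leaves G \<Longrightarrow> leaf_walks v = {[]}"
proof -
  assume v: "v \<in> leaves G"
  have "p = []" if "awalk v p l" for p l
    using that v by (cases p) (auto simp: leaves_def awalk_Cons_iff)
  then show ?thesis
    using v by (auto simp: leaf_walks_def leaves_def awalk_Nil_iff)
qed

lemma leaf_walks_step:
  "v \<in> verts G - leaves G \<Longrightarrow> leaf_walks v = (\<Union>e\<in>out_arcs G v. (#) e ` leaf_walks (head G e))"
proof (intro equalityI subsetI)
  fix p assume v: "v \<in> verts G - leaves G" and p: "p \<in> leaf_walks v"
  then obtain l where l: "l \<in> leaves G" "awalk v p l"
    by (auto simp: leaf_walks_def)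
  then show "p \<in> (\<Union>e\<in>out_arcs G v. (#) e ` leaf_walks (head G e))"
    using v by (cases p) (auto simp: awalk_Nil_iff awalk_Cons_iff leaf_walks_def image_iff)
qed (auto simp: leaf_walks_def awalk_Cons_iff)

text \<open>Interpolating polynomials with the label of each edge \<open>e\<close> replaced by the ring element \<open>g e\<close>.\<close>

definition walk_sum :: "('e \<Rightarrow> 'a::comm_ring_1) \<Rightarrow> 'v \<Rightarrow> 'a" where
  "walk_sum g v = (\<Sum>p\<in>leaf_walks v. \<Prod>e\<leftarrow>p. g e)"

lemma interp_poly_eq_walk_sum: "interp_poly G \<theta> v = walk_sum (\<lambda>e. PVar (\<theta> e)) v"
  by (simp add: interp_poly_def walk_sum_def leaf_walks_def)

lemma ring_map_walk_sum: "comm_ring_map h \<Longrightarrow> h (walk_sum g v) = walk_sum (\<lambda>e. h (g e)) v"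
  by (simp add: walk_sum_def comm_ring_map.sum comm_ring_map.prod_list)

lemma walk_sum_leaf: "v \<in> leaves G \<Longrightarrow> walk_sum g v = 1"
  by (simp add: walk_sum_def leaf_walks_leaf)

text \<open>The first arc splits the walks to leaves into disjoint classes. This recursion over the
  children is the form in which interpolating polynomials are used.\<close>

lemma walk_sum_step:
  assumes "v \<in> verts G - leaves G"
  shows "walk_sum g v = (\<Sum>e\<in>out_arcs G v. g e * walk_sum g (head G e))"
proof -
  have "walk_sum g v = (\<Sum>e\<in>out_arcs G v. \<Sum>p\<in>(#) e ` leaf_walks (head G e). \<Prod>e\<leftarrow>p. g e)"
    unfolding walk_sum_def leaf_walks_step[OF assms]
    by (rule sum.UNION_disjoint) (auto simp: finite_leaf_walks)
  also have "\<dots> = (\<Sum>e\<in>out_arcs G v. g e * walk_sum g (head G e))"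
    by (intro sum.cong refl) (simp add: sum.reindex walk_sum_def sum_distrib_left)
  finally show ?thesis .
qed

lemma walk_sum_pos:
  fixes g :: "'e \<Rightarrow> real"
  assumes "v \<in> verts G" "\<And>e. g e > 0"
  shows "walk_sum g v > 0"
  using assms(1)
proof (induction rule: descending_induct)
  case (step v)
  show ?case
  proof (cases "v \<in> leaves G")
    case False
    then have "out_arcs G v \<noteq> {}"
      using step.hyps by (auto simp: leaves_def)
    then show ?thesis
      using False step assms(2) by (subst walk_sum_step) (auto intro!: sum_pos)
  qed (simp add: walk_sum_leaf)
qed

text \<open>The descendants of \<open>u\<close> are closed under outgoing arcs, so restricting to
  them creates no new leaves.\<close>

lemma leaves_subtree: "leaves (subtree G u) = {l \<in> leaves G. \<exists>p. awalk u p l}"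
proof -
  have "out_arcs (subtree G u) v = out_arcs G v" if "u \<rightarrow>\<^sup>*\<^bsub>G\<^esub> v" for v
  proof -
    have "u \<rightarrow>\<^sup>*\<^bsub>G\<^esub> head G e" if "e \<in> out_arcs G v" for e
      using \<open>u \<rightarrow>\<^sup>*\<^bsub>G\<^esub> v\<close> that by (auto simp: reachable_adj_trans in_arcs_imp_in_arcs_ends)
    then show ?thesis
      using that by (auto simp: subtree_def)
  qed
  moreover have "v \<in> verts G" if "u \<rightarrow>\<^sup>*\<^bsub>G\<^esub> v" for v
    using that by (simp add: reachable_in_verts)
  ultimately show ?thesis
    by (auto simp: leaves_def reachable_awalk[symmetric]) (auto simp: subtree_def)
qed

end

lemma finite_rooted_tree_iff: "finite_rooted_tree G r \<longleftrightarrow> rooted_tree G r"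
  by (auto simp: finite_rooted_tree_def finite_rooted_tree_axioms_def rooted_tree_def)


section \<open>Staged trees\<close>

locale staged_rooted_tree = finite_rooted_tree G r for G :: "('v, 'e) pre_digraph" and r :: 'v +
  fixes \<theta> :: "'e \<Rightarrow> 'l"
  assumes card_out_labels: "v \<in> verts G \<Longrightarrow> card (out_labels G \<theta> v) = card (out_arcs G v)"
    and out_labels_eq_or_disjoint: "v \<in> verts G \<Longrightarrow> w \<in> verts G \<Longrightarrow>
      out_labels G \<theta> v = out_labels G \<theta> w \<or> out_labels G \<theta> v \<inter> out_labels G \<theta> w = {}"
begin

lemma inj_on_out_arcs: "v \<in> verts G \<Longrightarrow> inj_on \<theta> (out_arcs G v)"
  using card_out_labels[of v] by (intro eq_card_imp_inj_on) (auto simp: out_labels_def)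

lemma same_stage_if_common_label:
  assumes "e \<in> arcs G" "f \<in> arcs G" "\<theta> e = \<theta> f"
  shows "same_stage G \<theta> (tail G e) (tail G f)"
proof -
  have "\<theta> e \<in> out_labels G \<theta> (tail G e)" "\<theta> f \<in> out_labels G \<theta> (tail G f)"
    using assms(1,2) by (auto simp: out_labels_def)
  then show ?thesis
    using out_labels_eq_or_disjoint[of "tail G e" "tail G f"] assms by (auto simp: same_stage_def)
qed

definition real_sum :: "('l \<Rightarrow> real) \<Rightarrow> 'v \<Rightarrow> real" where
  "real_sum x = walk_sum (\<lambda>e. x (\<theta> e))"

lemma real_eval_interp_poly: "real_eval x (interp_poly G \<theta> v) = real_sum x v"
  unfolding interp_poly_eq_walk_sum real_sum_def
  by (subst ring_map_walk_sum[where h = "real_eval x", OF real_eval.comm_ring_map_axioms])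
     (simp add: real_eval_PVar)

lemma real_sum_pos: "v \<in> verts G \<Longrightarrow> (\<And>l. x l > 0) \<Longrightarrow> real_sum x v > 0"
  unfolding real_sum_def by (rule walk_sum_pos) auto

text \<open>Multiplying t(v_i) t(w_j) = t(w_i) t(v_j) by the value of the j-th label and summing
  over j turns w_j and v_j into their parents. Where the values are positive, the ratio of child to
  parent thus depends only on the label.\<close>

lemma balanced_real_sum_child:
  assumes "balanced G \<theta>" "e \<in> arcs G" "f \<in> arcs G" "\<theta> e = \<theta> f"
  shows "real_sum x (head G e) * real_sum x (tail G f) =
         real_sum x (head G f) * real_sum x (tail G e)"
proof -
  let ?v = "tail G e" and ?w = "tail G f"
  have v: "?v \<in> verts G - leaves G" and w: "?w \<in> verts G - leaves G"
    using assms(2,3) by (auto simp: leaves_def)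
  have stage: "same_stage G \<theta> ?v ?w"
    using assms by (intro same_stage_if_common_label)
  then have pair: "balanced_pair G \<theta> ?v ?w"
    using assms(1) v w by (auto simp: balanced_def)
  have labels: "\<theta> ` out_arcs G ?v = \<theta> ` out_arcs G ?w"
    using stage by (simp add: same_stage_def out_labels_def)
  \<comment> \<open>Matches each arc leaving \<open>?w\<close> with the arc leaving
    \<open>?v\<close> that carries the same label.\<close>
  define m where "m = inv_into (out_arcs G ?v) \<theta> \<circ> \<theta>"
  have m: "m f' \<in> out_arcs G ?v" "\<theta> (m f') = \<theta> f'" if "f' \<in> out_arcs G ?w" for f'
  proof -
    have "\<theta> f' \<in> \<theta> ` out_arcs G ?v"
      using that labels by auto
    then show "m f' \<in> out_arcs G ?v" "\<theta> (m f') = \<theta> f'"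
      unfolding m_def comp_def by (rule inv_into_into, rule f_inv_into_f)
  qed
  have inj_v: "inj_on \<theta> (out_arcs G ?v)" and inj_w: "inj_on \<theta> (out_arcs G ?w)"
    using inj_on_out_arcs v w by auto
  have "inj_on m (out_arcs G ?w)"
  proof (rule inj_onI)
    fix a b assume ab: "a \<in> out_arcs G ?w" "b \<in> out_arcs G ?w" "m a = m b"
    then have "\<theta> a = \<theta> b"
      using m(2)[OF ab(1)] m(2)[OF ab(2)] by simp
    then show "a = b"
      using inj_onD[OF inj_w] ab by blast
  qed
  moreover have "m ` out_arcs G ?w = out_arcs G ?v"
  proof (intro equalityI subsetI)
    fix e' assume e': "e' \<in> out_arcs G ?v"
    then have "\<theta> e' \<in> \<theta> ` out_arcs G ?w"
      unfolding labels[symmetric] by (rule imageI)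
    then obtain f' where f': "f' \<in> out_arcs G ?w" "\<theta> e' = \<theta> f'"
      by blast
    then have "m f' = e'"
      by (intro inj_onD[OF inj_v]) (simp_all add: m[OF f'(1)] e' del: in_out_arcs_conv)
    then show "e' \<in> m ` out_arcs G ?w"
      using f' by auto
  qed (use m(1) in blast)
  ultimately have bij: "bij_betw m (out_arcs G ?w) (out_arcs G ?v)"
    by (simp add: bij_betw_def)
  have cross: "real_sum x (head G e) * real_sum x (head G f') =
      real_sum x (head G f) * real_sum x (head G (m f'))" if f': "f' \<in> out_arcs G ?w" for f'
  \<comment> \<open>The definition of \<open>balanced_pair\<close> speaks only of distinct arcs; in
    the remaining case \<open>f' = f\<close> and the equation is commutativity.\<close>
  proof (cases "m f' = e")
    case True
    then have "f' = f"
      by (intro inj_onD[OF inj_w]) (use m(2)[OF f'] f' assms(3,4) in auto)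
    then show ?thesis
      using True by simp
  next
    case False
    then have "interp_poly G \<theta> (head G e) * interp_poly G \<theta> (head G f') =
        interp_poly G \<theta> (head G f) * interp_poly G \<theta> (head G (m f'))"
      using pair m[OF f'] f' assms(2-4) by (auto simp: balanced_pair_def)
    from arg_cong[OF this, of "real_eval x"] show ?thesis
      by (simp add: real_eval.mult real_eval_interp_poly)
  qed
  have "real_sum x (head G e) * real_sum x ?w =
      (\<Sum>f'\<in>out_arcs G ?w. x (\<theta> f') * (real_sum x (head G e) * real_sum x (head G f')))"
    using walk_sum_step[OF w, of "\<lambda>e. x (\<theta> e)"] by (simp add: real_sum_def sum_distrib_left mult_ac)
  also have "\<dots> = (\<Sum>f'\<in>out_arcs G ?w. x (\<theta> (m f')) * (real_sum x (head G f) * real_sum x (head G (m f'))))"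
    by (intro sum.cong refl) (simp add: cross m(2))
  also have "\<dots> = (\<Sum>e'\<in>out_arcs G ?v. x (\<theta> e') * (real_sum x (head G f) * real_sum x (head G e')))"
    by (rule sum.reindex_bij_betw[OF bij])
  also have "\<dots> = real_sum x (head G f) * real_sum x ?v"
    using walk_sum_step[OF v, of "\<lambda>e. x (\<theta> e)"] by (simp add: real_sum_def sum_distrib_left mult_ac)
  finally show ?thesis .
qed

text \<open>The conditional edge probabilities of the path measure with edge weights \<open>x\<close>. Independence of
  the chosen edge is exactly where balancedness enters.\<close>

definition normalized :: "('l \<Rightarrow> real) \<Rightarrow> 'l \<Rightarrow> real" where
  "normalized x l = (let e = SOME e. e \<in> arcs G \<and> \<theta> e = l in
     x l * real_sum x (head G e) / real_sum x (tail G e))"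

context
  fixes x :: "'l \<Rightarrow> real"
  assumes balanced: "balanced G \<theta>" and pos: "\<And>l. x l > 0"
begin

text \<open>The identity between children and parents may be divided by the values at the two tails,
  which are positive.\<close>

lemma normalized_label:
  assumes "e \<in> arcs G"
  shows "normalized x (\<theta> e) = x (\<theta> e) * real_sum x (head G e) / real_sum x (tail G e)"
proof -
  define f where "f = (SOME f. f \<in> arcs G \<and> \<theta> f = \<theta> e)"
  have f: "f \<in> arcs G" "\<theta> f = \<theta> e"
    using someI[of "\<lambda>f. f \<in> arcs G \<and> \<theta> f = \<theta> e" e] assms by (auto simp: f_def)
  have "real_sum x (tail G e) > 0" "real_sum x (tail G f) > 0"
    using f assms pos by (auto intro!: real_sum_pos)
  moreover have "real_sum x (head G f) * real_sum x (tail G e) =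
      real_sum x (head G e) * real_sum x (tail G f)"
    by (rule balanced_real_sum_child) (use balanced f assms in auto)
  ultimately show ?thesis
    by (simp add: normalized_def Let_def f_def[symmetric] field_simps)
qed

text \<open>This is the recursion for the value at \<open>v\<close>, divided by that value.\<close>

lemma sum_normalized:
  assumes "v \<in> verts G - leaves G"
  shows "(\<Sum>e\<in>out_arcs G v. normalized x (\<theta> e)) = 1"
proof -
  have "(\<Sum>e\<in>out_arcs G v. normalized x (\<theta> e)) =
      (\<Sum>e\<in>out_arcs G v. x (\<theta> e) * real_sum x (head G e)) / real_sum x v"
    unfolding sum_divide_distrib by (intro sum.cong refl) (auto simp: normalized_label)
  also have "\<dots> = real_sum x v / real_sum x v"
    using walk_sum_step[OF assms, of "\<lambda>e. x (\<theta> e)"] by (simp add: real_sum_def)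
  also have "\<dots> = 1"
    using real_sum_pos[of v x] assms pos by auto
  finally show ?thesis .
qed

text \<open>The factors t(head) / t(tail) telescope along the walk; the statement is cleared of
  denominators.\<close>

lemma prod_normalized:
  assumes "awalk v p w"
  shows "(\<Prod>e\<leftarrow>p. normalized x (\<theta> e)) * real_sum x v = (\<Prod>e\<leftarrow>p. x (\<theta> e)) * real_sum x w"
  using assms
proof (induction p arbitrary: v)
  case (Cons e p)
  then have e: "e \<in> arcs G" "v = tail G e" and p: "awalk (head G e) p w"
    by (auto simp: awalk_Cons_iff)
  have "real_sum x v > 0"
    using e pos by (auto intro!: real_sum_pos)
  then have step: "normalized x (\<theta> e) * real_sum x v = x (\<theta> e) * real_sum x (head G e)"
    using e by (simp add: normalized_label)
  have "(\<Prod>e\<leftarrow>e # p. normalized x (\<theta> e)) * real_sum x v =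
      (normalized x (\<theta> e) * real_sum x v) * (\<Prod>e\<leftarrow>p. normalized x (\<theta> e))"
    by simp
  also have "\<dots> = x (\<theta> e) * ((\<Prod>e\<leftarrow>p. normalized x (\<theta> e)) * real_sum x (head G e))"
    unfolding step by simp
  also have "\<dots> = (\<Prod>e\<leftarrow>e # p. x (\<theta> e)) * real_sum x w"
    unfolding Cons.IH[OF p] by simp
  finally show ?case .
qed (auto simp: awalk_Nil_iff)

end

end

lemma staged_rooted_tree_iff: "staged_rooted_tree G r \<theta> \<longleftrightarrow> staged_tree G r \<theta>"
  by (auto simp: staged_rooted_tree_def staged_rooted_tree_axioms_def staged_tree_def
      finite_rooted_tree_iff)


section \<open>The kernels\<close>

definition outcome_monomial ::
    "('v, 'e) pre_digraph \<Rightarrow> ('e \<Rightarrow> 'l) \<Rightarrow> 'v \<times> 'v \<Rightarrow> ('v, 'l) param_indet rpoly" where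
  "outcome_monomial G \<theta> =
     (\<lambda>(u, l). PVar (SourceIndet u) * (\<Prod>e\<leftarrow>tree_path G u l. PVar (LabelIndet (\<theta> e))))"

lemma psi_toric_eq: "psi_toric G \<theta> = poly_subst (outcome_monomial G \<theta>)"
  by (simp add: psi_toric_def outcome_monomial_def)

lemma prod_list_PVar_monomial: "\<exists>m. (\<Prod>e\<leftarrow>p. PVar (f e)) = Poly_Mapping.single m 1"
proof (induction p)
  case (Cons e p)
  then obtain m where m: "(\<Prod>e\<leftarrow>p. PVar (f e)) = Poly_Mapping.single m 1"
    by blast
  show ?case
    unfolding list.map prod_list.Cons m
    by (rule exI[of _ "Poly_Mapping.single (f e) 1 + m"]) (simp add: PVar_def mult_single)
qed (auto intro!: exI[of _ 0])

lemma monomial_map_outcome_monomial: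
  fixes G :: "('v, 'e) pre_digraph" and \<theta> :: "'e \<Rightarrow> 'l"
  shows "monomial_map (outcome_monomial G \<theta>)"
  unfolding monomial_map_def
proof
  fix ul :: "'v \<times> 'v"
  obtain u l where ul: "ul = (u, l)"
    by (rule prod.exhaust)
  obtain m where m: "(\<Prod>e\<leftarrow>tree_path G u l. PVar (LabelIndet (\<theta> e))) =
      (Poly_Mapping.single m 1 :: ('v, 'l) param_indet rpoly)"
    using prod_list_PVar_monomial[of "\<lambda>e. LabelIndet (\<theta> e)"] by blast
  show "\<exists>m. outcome_monomial G \<theta> ul = Poly_Mapping.single m 1"
    unfolding ul outcome_monomial_def prod.case m
    by (rule exI[of _ "Poly_Mapping.single (SourceIndet u) 1 + m"]) (simp add: PVar_def mult_single)
qed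

section \<open>The sum-to-one ideal and explicit forms of the two kernels\<close>

context interventional_staged_tree
begin

sublocale staged_rooted_tree G r \<theta>
  unfolding staged_rooted_tree_iff by (rule staged)

abbreviation "P \<equiv> outcome_indets G r k"
abbreviation "Q \<equiv> param_indets G r L k"
abbreviation "q \<equiv> sum_to_one_ideal G r \<theta> L k"

definition sum_to_one_gens :: "('v, 'l) param_indet rpoly set" where
  "sum_to_one_gens = {(\<Sum>e\<in>out_arcs G v. PVar (LabelIndet (\<theta> e))) - 1 | v.
     v \<in> verts G - leaves G \<and> level G r v \<ge> k}"

lemma LabelIndet_in: "e \<in> arcs G \<Longrightarrow> level G r (tail G e) \<ge> k \<Longrightarrow> LabelIndet (\<theta> e) \<in> Q"
  using labels_L by (auto simp: param_indets_def)

lemma sum_to_one_gens_carrier: "sum_to_one_gens \<subseteq> carrier (poly_ring Q)"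
proof -
  have "poly_indets ((\<Sum>e\<in>out_arcs G v. PVar (LabelIndet (\<theta> e))) - 1) \<subseteq> Q"
    if "level G r v \<ge> k" for v
    by (intro poly_indets_diff poly_indets_sum) (use that LabelIndet_in in auto)
  then show ?thesis
    unfolding sum_to_one_gens_def poly_ring_simps by blast
qed

lemma ideal_q: "ideal q (poly_ring Q)"
  unfolding sum_to_one_ideal_def sum_to_one_gens_def[symmetric]
  by (rule ring.genideal_ideal[OF cring.axioms(1)[OF cring_poly_ring] sum_to_one_gens_carrier])

sublocale q: poly_ideal Q q
  by (intro poly_ideal.intro ideal_q)

lemma sum_to_one_in_q:
  assumes "v \<in> verts G - leaves G" "level G r v \<ge> k"
  shows "(\<Sum>e\<in>out_arcs G v. PVar (LabelIndet (\<theta> e))) - 1 \<in> q"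
  using ring.genideal_self[OF cring.axioms(1)[OF cring_poly_ring] sum_to_one_gens_carrier] assms
  unfolding sum_to_one_ideal_def sum_to_one_gens_def[symmetric]
  by (auto simp: sum_to_one_gens_def)

text \<open>The polynomials vanishing at \<open>y\<close> form an ideal that contains the
  generators, hence all of \<open>q\<close>.\<close>

lemma q_vanishes:
  assumes "\<And>v. v \<in> verts G - leaves G \<Longrightarrow> (\<Sum>e\<in>out_arcs G v. y (LabelIndet (\<theta> e))) = 1"
    and "g \<in> q"
  shows "real_eval y g = 0"
proof -
  let ?I = "{f. poly_indets f \<subseteq> Q \<and> real_eval y f = 0}"
  have "real_eval y g = 0" if "g \<in> sum_to_one_gens" for g
    using that assms(1)
    by (auto simp: sum_to_one_gens_def real_eval.diff real_eval.sum real_eval_PVar real_eval.one)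
  then have "sum_to_one_gens \<subseteq> ?I"
    using sum_to_one_gens_carrier by auto
  then have "q \<subseteq> ?I"
    unfolding sum_to_one_ideal_def sum_to_one_gens_def[symmetric]
    by (intro ring.genideal_minimal[OF cring.axioms(1)[OF cring_poly_ring]]
        ideal_real_eval_vanishing)
  then show ?thesis
    using assms(2) by auto
qed

lemma outcome_awalk:
  assumes "(u, l) \<in> P"
  shows "awalk u (tree_path G u l) l" "l \<in> leaves G" "u \<in> level_set G r k"
  using assms by (auto simp: outcome_indets_def leaves_subtree tree_path_eq)

text \<open>Levels only grow along a walk. A walk starting at level at least \<open>k\<close>
  therefore meets only labels from \<open>L\<close>, which keeps its monomial in the parameter
  ring.\<close>

lemma awalk_levels: "awalk v p w \<Longrightarrow> e \<in> set p \<Longrightarrow> e \<in> arcs G \<and> level G r v \<le> level G r (tail G e)"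
proof (induction p arbitrary: v)
  case (Cons f p)
  then have f: "f \<in> arcs G" "v = tail G f" "awalk (head G f) p w"
    by (auto simp: awalk_Cons_iff)
  show ?case
  proof (cases "e = f")
    case False
    then have "e \<in> arcs G \<and> level G r (head G f) \<le> level G r (tail G e)"
      using Cons.prems by (intro Cons.IH[OF f(3)]) simp
    then show ?thesis
      using f level_head[OF f(1)] by simp
  qed (use f in simp)
qed simp

lemma awalk_labels_in:
  "awalk v p w \<Longrightarrow> level G r v \<ge> k \<Longrightarrow> poly_indets (\<Prod>e\<leftarrow>p. PVar (LabelIndet (\<theta> e))) \<subseteq> Q"
  by (intro poly_indets_prod_list) (auto intro!: LabelIndet_in dest: awalk_levels)

lemma outcome_monomial_in:
  assumes "ul \<in> P"
  shows "poly_indets (outcome_monomial G \<theta> ul) \<subseteq> Q"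
proof (cases ul)
  case (Pair u l)
  then show ?thesis
    using outcome_awalk[of u l] assms awalk_labels_in[of u "tree_path G u l" l]
    unfolding Pair outcome_monomial_def prod.case
    by (intro poly_indets_mult) (auto simp: level_set_def param_indets_def)
qed

lemma psi_toric_in: "poly_indets f \<subseteq> P \<Longrightarrow> poly_indets (psi_toric G \<theta> f) \<subseteq> Q"
  unfolding psi_toric_eq by (rule poly_indets_poly_subst) (auto dest: outcome_monomial_in)

lemma ker_psi_toric_eq: "ker_psi_toric G r \<theta> L k = {f. poly_indets f \<subseteq> P \<and> psi_toric G \<theta> f = 0}"
  by (auto simp: ker_psi_toric_def a_kernel_def' )

text \<open>The zero of the quotient is the coset \<open>q\<close> itself, and a coset equals
  \<open>q\<close> exactly when its representative lies in \<open>q\<close>.\<close>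

lemma ker_psi_eq: "ker_psi G r \<theta> L k = {f. poly_indets f \<subseteq> P \<and> psi_toric G \<theta> f \<in> q}"
proof -
  interpret cring "poly_ring Q"
    by (rule cring_poly_ring)
  have coset_eq_iff: "q +>\<^bsub>poly_ring Q\<^esub> g = q \<longleftrightarrow> g \<in> q" if "poly_indets g \<subseteq> Q" for g
    using that a_rcos_zero[OF ideal_q] ideal.rcos_const_imp_mem[OF ideal_q] by auto
  then show ?thesis
    unfolding ker_psi_def a_kernel_def' psi_def FactRing_def
    by (simp add: coset_eq_iff[OF psi_toric_in] cong: conj_cong)
qed

lemma ker_psi_toric_subset: "ker_psi_toric G r \<theta> L k \<subseteq> ker_psi G r \<theta> L k"
  by (auto simp: ker_psi_toric_eq ker_psi_eq q.zero)

section \<open>From balancedness to equality of the kernels\<close>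

lemma kernels_eq_if_balanced:
  assumes "balanced G \<theta>"
  shows "ker_psi_toric G r \<theta> L k = ker_psi G r \<theta> L k"
proof (intro equalityI ker_psi_toric_subset subsetI)
  fix f assume "f \<in> ker_psi G r \<theta> L k"
  then have f: "poly_indets f \<subseteq> P" "psi_toric G \<theta> f \<in> q"
    by (auto simp: ker_psi_eq)
  have "psi_toric G \<theta> f = 0"
  proof (rule rpoly_eq_0_if_vanishes_on_positives)
    fix y :: "('v, 'l) param_indet \<Rightarrow> real"
    assume y: "\<And>i. y i > 0"
    define x where "x l = y (LabelIndet l)" for l
    have x: "x l > 0" for l
      using y by (simp add: x_def)
    \<comment> \<open>The renormalized point: labels carry the conditional edge probabilities, and
      the source coordinate absorbs the factor \<open>real_sum x u\<close> left over by
      telescoping.\<close>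
    define y' where "y' i = (case i of SourceIndet u \<Rightarrow> y (SourceIndet u) * real_sum x u
      | LabelIndet l \<Rightarrow> normalized x l)" for i
    have "real_eval y (outcome_monomial G \<theta> ul) = real_eval y' (outcome_monomial G \<theta> ul)"
      if ul: "ul \<in> P" for ul
    proof (cases ul)
      case (Pair u l)
      note * = outcome_awalk[OF ul[unfolded Pair]]
      \<comment> \<open>At the leaf end of the path the telescoping product leaves no
        factor.\<close>
      have "real_sum x l = 1"
        using *(2) by (simp add: real_sum_def walk_sum_leaf)
      with prod_normalized[OF assms x *(1)] have
        "(\<Prod>e\<leftarrow>tree_path G u l. normalized x (\<theta> e)) * real_sum x u = (\<Prod>e\<leftarrow>tree_path G u l. x (\<theta> e))"
        by simp
      then show ?thesis
        by (simp add: Pair outcome_monomial_def real_eval.mult real_eval.prod_list real_eval_PVar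
            y'_def x_def mult_ac)
    qed
    then have "real_eval y (psi_toric G \<theta> f) = real_eval y' (psi_toric G \<theta> f)"
      unfolding psi_toric_eq real_eval_poly_subst
      by (rule poly_eval_cong) (use f(1) in auto)
    also have "\<dots> = 0"
      by (rule q_vanishes[OF _ f(2)]) (simp add: y'_def sum_normalized[OF assms x])
    finally show "real_eval y (psi_toric G \<theta> f) = 0" .
  qed
  with f show "f \<in> ker_psi_toric G r \<theta> L k"
    by (simp add: ker_psi_toric_eq)
qed

section \<open>From equality of the kernels to balancedness\<close>

definition param_sum :: "'v \<Rightarrow> ('v, 'l) param_indet rpoly" where
  "param_sum = walk_sum (\<lambda>e. PVar (LabelIndet (\<theta> e)))"

text \<open>The two polynomials live in different rings, over parameters and over labels, and are
  compared through their values.\<close>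

lemma real_eval_param_sum:
  "real_eval y (param_sum v) = real_eval (\<lambda>l. y (LabelIndet l)) (interp_poly G \<theta> v)"
  unfolding param_sum_def real_eval_interp_poly real_sum_def
  by (subst ring_map_walk_sum[where h = "real_eval y", OF real_eval.comm_ring_map_axioms])
     (simp add: real_eval_PVar)

text \<open>From the leaves upwards: t(v) - 1 is the sum of label times t(child) - 1 over the arcs
  leaving v, plus the generator of \<open>q\<close> at v.\<close>

lemma param_sum_minus_one_in_q:
  assumes "v \<in> verts G" "level G r v \<ge> k"
  shows "param_sum v - 1 \<in> q"
  using assms
proof (induction rule: descending_induct)
  case (step v)
  show ?case
  proof (cases "v \<in> leaves G")
    case True
    then show ?thesis
      by (simp add: param_sum_def walk_sum_leaf q.zero)
  next
    case False
    then have v: "v \<in> verts G - leaves G"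
      using step.hyps by simp
    have "param_sum v - 1 =
        (\<Sum>e\<in>out_arcs G v. PVar (LabelIndet (\<theta> e)) * (param_sum (head G e) - 1)) +
        ((\<Sum>e\<in>out_arcs G v. PVar (LabelIndet (\<theta> e))) - 1)"
      using walk_sum_step[OF v, of "\<lambda>e. PVar (LabelIndet (\<theta> e)) :: ('v, 'l) param_indet rpoly"]
      by (simp add: param_sum_def right_diff_distrib sum_subtractf)
    also have "\<dots> \<in> q"
    proof (intro q.add q.sum q.mult sum_to_one_in_q v step.prems)
      fix e assume e: "e \<in> out_arcs G v"
      then show "param_sum (head G e) - 1 \<in> q"
        using step.prems level_head[of e] by (intro step.IH) auto
      show "poly_indets (PVar (LabelIndet (\<theta> e))) \<subseteq> Q"
        using e step.prems LabelIndet_in[of e] by auto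
    qed
    finally show ?thesis .
  qed
qed

lemma param_sum_in:
  assumes "v \<in> verts G" "level G r v \<ge> k"
  shows "poly_indets (param_sum v) \<subseteq> Q"
  using poly_indets_add[OF q.indets[OF param_sum_minus_one_in_q[OF assms]], of 1] by simp

text \<open>The sum p_v of the outcome variables below \<open>v\<close>. Its superscript
  \<open>u\<close> is meant to be the ancestor of \<open>v\<close> at level
  \<open>k\<close>.\<close>

definition outcome_sum :: "'v \<Rightarrow> 'v \<Rightarrow> ('v \<times> 'v) rpoly" where
  "outcome_sum u v = (\<Sum>p\<in>leaf_walks v. PVar (u, awlast v p))"

lemma outcome_sum_in:
  assumes "u \<in> level_set G r k" "awalk u p v"
  shows "poly_indets (outcome_sum u v) \<subseteq> P"
  unfolding outcome_sum_def
proof (rule poly_indets_sum)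
  fix s assume "s \<in> leaf_walks v"
  then obtain l where l: "l \<in> leaves G" "awalk v s l"
    by (auto simp: leaf_walks_def)
  then have "\<exists>p. awalk u p l"
    using assms(2) by (blast intro: awalk_appendI)
  then show "poly_indets (PVar (u, awlast v s)) \<subseteq> P"
    using l assms(1) by (simp add: outcome_indets_def leaves_subtree)
qed

text \<open>By uniqueness of walks, the path from \<open>u\<close> to a leaf below \<open>v\<close>
  runs through \<open>v\<close>, so the monomial of \<open>p\<close> factors out.\<close>

lemma psi_toric_outcome_sum:
  assumes "awalk u p v"
  shows "psi_toric G \<theta> (outcome_sum u v) =
    PVar (SourceIndet u) * (\<Prod>e\<leftarrow>p. PVar (LabelIndet (\<theta> e))) * param_sum v"
proof -
  have "outcome_monomial G \<theta> (u, awlast v s) = PVar (SourceIndet u) *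
      (\<Prod>e\<leftarrow>p. PVar (LabelIndet (\<theta> e))) * (\<Prod>e\<leftarrow>s. PVar (LabelIndet (\<theta> e)))"
    if s: "s \<in> leaf_walks v" for s
  proof -
    obtain l where l: "l \<in> leaves G" "awalk v s l"
      using s by (auto simp: leaf_walks_def)
    then have "awalk u (p @ s) l"
      using assms by (blast intro: awalk_appendI)
    from tree_path_eq[OF this] show ?thesis
      using l by (simp add: outcome_monomial_def mult.assoc)
  qed
  then show ?thesis
    by (simp add: psi_toric_eq outcome_sum_def poly_subst.sum poly_subst_PVar param_sum_def
        walk_sum_def sum_distrib_left)
qed

text \<open>A quadric in outcome sums is mapped to a monomial times the balancing difference. It
  lies in \<open>ker_psi\<close> because interpolating polynomials are \<open>1\<close> modulo
  \<open>q\<close>, and equality of the kernels then makes its image zero.\<close>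

lemma balanced_pair_if_kernels_eq:
  assumes ker: "ker_psi_toric G r \<theta> L k = ker_psi G r \<theta> L k"
    and v: "v \<in> verts G" "level G r v \<ge> k" and w: "w \<in> verts G" "level G r w \<ge> k"
  shows "balanced_pair G \<theta> v w"
  unfolding balanced_pair_def
proof (intro ballI impI, elim conjE)
  fix e e' f f'
  assume e: "e \<in> out_arcs G v" "e' \<in> out_arcs G v" and f: "f \<in> out_arcs G w" "f' \<in> out_arcs G w"
    and \<theta>: "\<theta> e = \<theta> f" "\<theta> e' = \<theta> f'"
  obtain a p where a: "a \<in> level_set G r k" "awalk a p v"
    using ancestor_at_level[OF v] by blast
  obtain b s where b: "b \<in> level_set G r k" "awalk b s w"
    using ancestor_at_level[OF w] by blast
  have child_v: "awalk a (p @ [d]) (head G d)" if "d \<in> out_arcs G v" for d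
    using that a(2) arc_awalk[of d] by (auto intro: awalk_appendI)
  have child_w: "awalk b (s @ [d]) (head G d)" if "d \<in> out_arcs G w" for d
    using that b(2) arc_awalk[of d] by (auto intro: awalk_appendI)
  \<comment> \<open>The monomial common to both products: \<open>e\<close> and \<open>f\<close>
    share a label, and so do \<open>e'\<close> and \<open>f'\<close>.\<close>
  define M where "M = PVar (SourceIndet a) * (\<Prod>e\<leftarrow>p. PVar (LabelIndet (\<theta> e))) *
    (PVar (SourceIndet b) * (\<Prod>e\<leftarrow>s. PVar (LabelIndet (\<theta> e)))) *
    (PVar (LabelIndet (\<theta> e)) * PVar (LabelIndet (\<theta> e')))"
  let ?t = "\<lambda>d. param_sum (head G d)"
  define D where "D = ?t e * ?t f' - ?t f * ?t e'"
  define g where "g = outcome_sum a (head G e) * outcome_sum b (head G f') -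
    outcome_sum b (head G f) * outcome_sum a (head G e')"
  have g: "poly_indets g \<subseteq> P"
    unfolding g_def
    by (intro poly_indets_diff poly_indets_mult outcome_sum_in[OF a(1) child_v]
        outcome_sum_in[OF b(1) child_w] e f)
  have psi_g: "psi_toric G \<theta> g = M * D"
    using \<theta> unfolding g_def psi_toric_eq poly_subst.diff poly_subst.mult
    unfolding psi_toric_eq[symmetric] psi_toric_outcome_sum[OF child_v[OF e(1)]]
      psi_toric_outcome_sum[OF child_v[OF e(2)]] psi_toric_outcome_sum[OF child_w[OF f(1)]]
      psi_toric_outcome_sum[OF child_w[OF f(2)]]
    by (simp add: M_def D_def algebra_simps)
  have level: "head G d \<in> verts G" "level G r (head G d) \<ge> k"
    if "d \<in> out_arcs G v \<union> out_arcs G w" for d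
    using that v w level_head[of d] by auto
  \<comment> \<open>Both products in \<open>D\<close> are congruent to \<open>1\<close> modulo
    \<open>q\<close>; this form displays \<open>D\<close> as a combination of terms t - 1.\<close>
  have "D = ?t f' * (?t e - 1) + (?t f' - 1) - ?t e' * (?t f - 1) - (?t e' - 1)"
    by (simp add: D_def algebra_simps)
  also have "\<dots> \<in> q"
    by (intro q.diff q.add q.mult param_sum_minus_one_in_q param_sum_in level) (use e f in auto)
  finally have "D \<in> q" .
  moreover have "poly_indets M \<subseteq> Q"
  proof -
    have "SourceIndet a \<in> Q" "SourceIndet b \<in> Q"
      using a(1) b(1) by (auto simp: param_indets_def)
    moreover have "LabelIndet (\<theta> e) \<in> Q" "LabelIndet (\<theta> e') \<in> Q"
      using LabelIndet_in[of e] LabelIndet_in[of e'] e v by auto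
    moreover have "poly_indets (\<Prod>e\<leftarrow>p. PVar (LabelIndet (\<theta> e))) \<subseteq> Q"
      "poly_indets (\<Prod>e\<leftarrow>s. PVar (LabelIndet (\<theta> e))) \<subseteq> Q"
      using a b by (intro awalk_labels_in[OF a(2)] awalk_labels_in[OF b(2)]; simp add: level_set_def)+
    ultimately show ?thesis
      unfolding M_def by (intro poly_indets_mult) simp_all
  qed
  ultimately have "M * D \<in> q"
    by (rule q.mult)
  then have "g \<in> ker_psi G r \<theta> L k"
    using g psi_g by (simp add: ker_psi_eq)
  then have MD: "M * D = 0"
    using psi_g by (simp add: ker[symmetric] ker_psi_toric_eq)
  let ?i = "\<lambda>d. interp_poly G \<theta> (head G d)"
  have "?i e * ?i f' - ?i f * ?i e' = 0"
  \<comment> \<open>Evaluation at positive points cancels \<open>M\<close>, which is positive there,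
    and at the same time carries the equation from the parameter ring to the ring of labels.\<close>
  proof (rule rpoly_eq_0_if_vanishes_on_positives)
    fix x :: "'l \<Rightarrow> real"
    assume x: "\<And>l. x l > 0"
    \<comment> \<open>Any positive value would do for the source coordinates, since they do not
      occur in \<open>D\<close>.\<close>
    define y where "y i = (case i of SourceIndet (u :: 'v) \<Rightarrow> 1 | LabelIndet l \<Rightarrow> x l)" for i
    have "(\<Prod>e\<leftarrow>p. x (\<theta> e)) > 0" for p
      by (induction p) (auto simp: x)
    then have "real_eval y M > 0"
      using x by (simp add: M_def real_eval.mult real_eval.prod_list real_eval_PVar y_def)
    moreover have "real_eval y M * real_eval y D = 0"
      using arg_cong[OF MD, of "real_eval y"] by (simp add: real_eval.mult real_eval.zero)
    ultimately have "real_eval y D = 0"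
      by auto
    then show "real_eval x (?i e * ?i f' - ?i f * ?i e') = 0"
      by (simp add: D_def real_eval.diff real_eval.mult real_eval_param_sum y_def)
  qed
  then show "?i e * ?i f' = ?i f * ?i e'"
    by simp
qed

text \<open>As \<open>A\<close> and \<open>L\<close> are disjoint, a label determines on which side
  of the splitting level its arcs start.\<close>

lemma level_less_k_iff:
  assumes "e \<in> arcs G" "f \<in> arcs G" "\<theta> e = \<theta> f"
  shows "level G r (tail G e) < k \<longleftrightarrow> level G r (tail G f) < k"
proof -
  have "level G r (tail G e) < k \<longleftrightarrow> \<theta> e \<in> A" if "e \<in> arcs G" for e
  proof
    show "\<theta> e \<in> A" if "level G r (tail G e) < k"
      unfolding labels_A[symmetric] using that \<open>e \<in> arcs G\<close> by blast
    show "level G r (tail G e) < k" if "\<theta> e \<in> A"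
    proof (rule ccontr)
      assume "\<not> ?thesis"
      then have "\<theta> e \<in> L"
        unfolding labels_L[symmetric] using \<open>e \<in> arcs G\<close> by simp
      then show False
        using that labels_disjoint by blast
    qed
  qed
  then show ?thesis
    using assms by simp
qed

lemma balanced_if_kernels_eq:
  assumes ker: "ker_psi_toric G r \<theta> L k = ker_psi G r \<theta> L k"
  shows "balanced G \<theta>"
  unfolding balanced_def
proof (intro ballI impI)
  fix v w assume v: "v \<in> verts G" and w: "w \<in> verts G" and stage: "same_stage G \<theta> v w"
  show "balanced_pair G \<theta> v w"
  proof (cases "level G r v \<ge> k \<and> level G r w \<ge> k")
    case True
    then show ?thesis
      using balanced_pair_if_kernels_eq[OF ker] v w by blast
  next
    \<comment> \<open>One of the vertices has level less than \<open>k\<close>. Unless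
      \<open>v\<close> is a leaf, a shared label puts both there, and triviality of those stages
      gives \<open>v = w\<close>.\<close>
    case False
    show ?thesis
    proof (cases "v \<in> leaves G")
      case True
      then show ?thesis
        by (simp add: balanced_pair_def leaves_def)
    next
      case v_inner: False
      then have "out_arcs G v \<noteq> {}"
        using v by (simp add: leaves_def)
      then obtain e where e: "e \<in> out_arcs G v"
        by blast
      then have "\<theta> e \<in> \<theta> ` out_arcs G w"
        using stage unfolding same_stage_def out_labels_def by blast
      then obtain f where f: "f \<in> out_arcs G w" "\<theta> f = \<theta> e"
        by force
      then have "w \<notin> leaves G"
        by (auto simp: leaves_def)
      moreover have "level G r v < k" "level G r w < k"
        using False level_less_k_iff[of e f] e f by auto
      ultimately have "v = w"
        using trivial_stages_above[of v w] v w v_inner stage by blast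
      \<comment> \<open>With \<open>v = w\<close>, equal labels force equal arcs, and the two sides
        of the balancing equation coincide.\<close>
      then have "e1 = f1" if "e1 \<in> out_arcs G v" "f1 \<in> out_arcs G w" "\<theta> e1 = \<theta> f1" for e1 f1
        using inj_onD[OF inj_on_out_arcs[OF w] that(3)] that by blast
      then show ?thesis
        unfolding balanced_pair_def by blast
    qed
  qed
qed

lemma toric_ideal_ker_psi_toric: "toric_ideal P (ker_psi_toric G r \<theta> L k)"
  unfolding ker_psi_toric_eq psi_toric_eq
  by (rule kernel_poly_subst_toric[OF monomial_map_outcome_monomial])

end

theorem theorem4p4:
  fixes G :: "('v, 'e) pre_digraph" and r :: 'v and \<theta> :: "'e \<Rightarrow> 'l"
    and A L :: "'l set" and k :: nat and ind :: "'l \<Rightarrow> 'w set"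
    and TL :: "('w, 'f) pre_digraph" and rL :: 'w
    and \<phi> :: "'v \<Rightarrow> ('v, 'e, 'w, 'f) digraph_isomorphism"
  assumes "interventional_staged_tree G r \<theta> A L k ind TL rL \<phi>"
  shows "(balanced G \<theta> \<longleftrightarrow> ker_psi_toric G r \<theta> L k = ker_psi G r \<theta> L k) \<and>
         (balanced G \<theta> \<longrightarrow> toric_ideal (outcome_indets G r k) (ker_psi G r \<theta> L k))"
proof -
  interpret interventional_staged_tree G r \<theta> A L k ind TL rL \<phi>
    by (rule assms)
  show ?thesis
    using kernels_eq_if_balanced balanced_if_kernels_eq toric_ideal_ker_psi_toric by auto
qed

end
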